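(* Let $A\in F^\infty(\mathbf B_\Lambda)$ have the formal Fourier representation $$\varphi(\{S_{i,s}\})=\sum_{(\beta_1,\dots,\beta_k)\in\mathbf F}c_{(\beta_1,\dots,\beta_k)}S_{1,\beta_1}\cdots S_{k,\beta_k}.$$ Then $\varphi(\{rS_{i,s}\})\in\mathcal A(\mathbf B_\Lambda)$ for all $r\in[0,1)$, $$A=\text{SOT-}\lim_{r\to1}\varphi(\{rS_{i,s}\}),$$ and $$\|A\|=\sup_{0\le r<1}\|\varphi(\{rS_{i,s}\})\|=\lim_{r\to1}\|\varphi(\{rS_{i,s}\})\|.$$
   Context: Let $k,n_1,\dots,n_k$ be positive integers. For $i,j\in\{1,\dots,k\}$, $i\ne j$, let $\Lambda_{ij}=[\lambda_{i,j}(s,t)]$ be an $n_i\times n_j$ matrix with entries in $\mathbb T=\{z\in\mathbb C:|z|=1\}$, with $\Lambda_{ji}=\Lambda_{ij}^*$, i.e. $\lambda_{j,i}(t,s)=\overline{\lambda_{i,j}(s,t)}$. Words: $\mathbb F_{n_i}^+$ is the unital free semigroup with generators $g^i_1,\dots,g^i_{n_i}$ and neutral element $g^i_0$; $|\alpha|$ is the length of a word. If $X_{i,1},\dots,X_{i,n_i}$ are operators and $\alpha=g^i_{p_1}\cdots g^i_{p_m}$, put $X_{i,\alpha}=X_{i,p_1}\cdots X_{i,p_m}$, and $X_{i,g^i_0}=I$. Set $\mathbf F=\mathbb F_{n_1}^+\times\cdots\times\mathbb F_{n_k}^+$. Universal model: on $\ell^2(\mathbf F)$ with orthonormal basis $\{\chi_{(\alpha_1,\dots,\alpha_k)}\}$,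 $$S_{i,s}\chi_{(\alpha_1,\dots,\alpha_k)}=\boldsymbol\lambda_{i,1}(s,\alpha_1)\cdots\boldsymbol\lambda_{i,i-1}(s,\alpha_{i-1})\,\chi_{(\alpha_1,\dots,\alpha_{i-1},g^i_s\alpha_i,\alpha_{i+1},\dots,\alpha_k)}$$ (no scalar factor if $i=1$), where $\boldsymbol\lambda_{i,j}(s,\beta)=\prod_{b=1}^q\lambda_{i,j}(s,j_b)$ for $\beta=g^j_{j_1}\cdots g^j_{j_q}$ and $\boldsymbol\lambda_{i,j}(s,g^j_0)=1$. For $\boldsymbol\beta=(\beta_1,\dots,\beta_k)\in\mathbf F$ put $\mathbf S_{\boldsymbol\beta}=S_{1,\beta_1}\cdots S_{k,\beta_k}$ and $|\boldsymbol\beta|=|\beta_1|+\cdots+|\beta_k|$. Noncommutative Hardy space: let $\{c_{\boldsymbol\beta}\}_{\boldsymbol\beta\in\mathbf F}\subset\mathbb C$ with $\sum|c_{\boldsymbol\beta}|^2<\infty$, and consider the formal series $\varphi(\{S_{i,s}\})=\sum_{\boldsymbol\beta}c_{\boldsymbol\beta}\mathbf S_{\boldsymbol\beta}$. For each $\boldsymbol\gamma\in\mathbf F$, $\varphi(\{S_{i,s}\})\chi_{\boldsymbol\gamma}:=\sum_{\boldsymbol\beta}c_{\boldsymbol\beta}\mathbf S_{\boldsymbol\beta}\chi_{\boldsymbol\gamma}$ is a vector of $\ell^2(\mathbf F)$, so $\varphi(\{S_{i,s}\})p$ is defined by linearity for $p$ in $\mathcal P:=\mathrm{span}\{\chi_{\boldsymbol\gamma}\}$.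 If $\sup_{p\in\mathcal P,\|p\|\le1}\|\varphi(\{S_{i,s}\})p\|<\infty$, there is a unique $A\in B(\ell^2(\mathbf F))$ with $Ap=\varphi(\{S_{i,s}\})p$ for all $p\in\mathcal P$. $F^\infty(\mathbf B_\Lambda)$ is the set of all operators $A$ obtained this way, and $\varphi(\{S_{i,s}\})$ is the formal Fourier representation of $A$. For $r\in[0,1)$, $\varphi(\{rS_{i,s}\}):=\sum_{p=0}^\infty\sum_{|\boldsymbol\beta|=p}r^{p}c_{\boldsymbol\beta}\mathbf S_{\boldsymbol\beta}$, the outer series being taken in the operator norm. $\mathcal A(\mathbf B_\Lambda)$ is the norm-closed non-self-adjoint algebra generated by all the $S_{i,s}$ and the identity. SOT is the strong operator topology. *)

theory Defs
  imports "HOL-Analysis.Analysis"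
begin

section \<open>Square-summable families\<close>

typedef 'a ell2 = "{f :: 'a \<Rightarrow> complex. (\<lambda>x. (cmod (f x))\<^sup>2) summable_on UNIV}"
  morphisms coord Abs_ell2
  by (rule exI[of _ "\<lambda>_. 0"]) simp

setup_lifting type_definition_ell2

lemma sq_summable_comparison:
  fixes f g :: "'a \<Rightarrow> real"
  assumes "f summable_on A" "\<And>x. x \<in> A \<Longrightarrow> 0 \<le> g x" "\<And>x. x \<in> A \<Longrightarrow> g x \<le> f x"
  shows "g summable_on A"
proof (rule nonneg_bdd_above_summable_on)
  show "bdd_above (sum g ` {F. F \<subseteq> A \<and> finite F})"
  proof (rule bdd_aboveI2)
    fix F assume F: "F \<in> {F. F \<subseteq> A \<and> finite F}"
    have "sum g F \<le> sum f F"
      using F assms(3) by (intro sum_mono) auto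
    also have "\<dots> \<le> infsum f A"
      using F assms by (intro finite_sum_le_infsum) (auto intro: order_trans)
    finally show "sum g F \<le> infsum f A" .
  qed
qed (use assms in auto)

lemma cmod_add_sq_le: "(cmod (a + b))\<^sup>2 \<le> 2 * (cmod a)\<^sup>2 + 2 * (cmod b)\<^sup>2"
proof -
  have "(cmod (a + b))\<^sup>2 \<le> (cmod a + cmod b)\<^sup>2"
    by (intro power_mono norm_triangle_ineq) simp
  also have "\<dots> \<le> 2 * (cmod a)\<^sup>2 + 2 * (cmod b)\<^sup>2"
    using zero_le_power2[of "cmod a - cmod b"] by (simp add: power2_eq_square algebra_simps)
  finally show ?thesis .
qed

lemma sq_summable_add:
  assumes "(\<lambda>x. (cmod (f x))\<^sup>2) summable_on A" "(\<lambda>x. (cmod (g x))\<^sup>2) summable_on A"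
  shows "(\<lambda>x. (cmod (f x + g x))\<^sup>2) summable_on A"
proof -
  have "(\<lambda>x. 2 * (cmod (f x))\<^sup>2 + 2 * (cmod (g x))\<^sup>2) summable_on A"
    using assms by (intro summable_on_add summable_on_cmult_right)
  then show ?thesis
    by (rule sq_summable_comparison) (auto simp: cmod_add_sq_le)
qed

lemma sq_summable_cmult:
  assumes "(\<lambda>x. (cmod (f x))\<^sup>2) summable_on A"
  shows "(\<lambda>x. (cmod (c * f x))\<^sup>2) summable_on A"
  using summable_on_cmult_right[OF assms, of "(cmod c)\<^sup>2"]
  by (simp add: norm_mult power_mult_distrib)

instantiation ell2 :: (type) real_vector
begin

lift_definition zero_ell2 :: "'a ell2" is "\<lambda>_. 0" by simp

lift_definition plus_ell2 :: "'a ell2 \<Rightarrow> 'a ell2 \<Rightarrow> 'a ell2" is "\<lambda>f g x. f x + g x"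
  by (rule sq_summable_add)

lift_definition uminus_ell2 :: "'a ell2 \<Rightarrow> 'a ell2" is "\<lambda>f x. - f x" by simp

lift_definition minus_ell2 :: "'a ell2 \<Rightarrow> 'a ell2 \<Rightarrow> 'a ell2" is "\<lambda>f g x. f x - g x"
proof -
  fix f g :: "'a \<Rightarrow> complex"
  assume "(\<lambda>x. (cmod (f x))\<^sup>2) summable_on UNIV" "(\<lambda>x. (cmod (g x))\<^sup>2) summable_on UNIV"
  then show "(\<lambda>x. (cmod (f x - g x))\<^sup>2) summable_on UNIV"
    using sq_summable_add[of f UNIV "\<lambda>x. - g x"] by simp
qed

lift_definition scaleR_ell2 :: "real \<Rightarrow> 'a ell2 \<Rightarrow> 'a ell2" is "\<lambda>r f x. complex_of_real r * f x"
  by (rule sq_summable_cmult)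

instance
  by standard (transfer; simp add: algebra_simps)+

end

lift_definition scaleC :: "complex \<Rightarrow> 'a ell2 \<Rightarrow> 'a ell2" (infixr \<open>*\<^sub>C\<close> 75)
  is "\<lambda>c f x. c * f x"
  by (rule sq_summable_cmult)

lemma coord_simps [simp]:
  "coord 0 x = 0"
  "coord (f + g) x = coord f x + coord g x"
  "coord (f - g) x = coord f x - coord g x"
  "coord (- f) x = - coord f x"
  "coord (r *\<^sub>R f) x = complex_of_real r * coord f x"
  "coord (c *\<^sub>C f) x = c * coord f x"
  by (transfer; simp)+

lemma ell2_eqI: "(\<And>x. coord f x = coord g x) \<Longrightarrow> f = g"
  by (metis coord_inverse ext)

lemma coord_sum [simp]: "coord (\<Sum>i\<in>I. f i) x = (\<Sum>i\<in>I. coord (f i) x)"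
  by (induction I rule: infinite_finite_induct) auto

lemma coord_sq_summable: "(\<lambda>x. (cmod (coord f x))\<^sup>2) summable_on A"
proof -
  have "(\<lambda>x. (cmod (coord f x))\<^sup>2) summable_on UNIV"
    using coord[of f] by simp
  then show ?thesis
    by (rule summable_on_subset_banach) simp
qed

interpretation ell2: vector_space "scaleC :: complex \<Rightarrow> 'a ell2 \<Rightarrow> 'a ell2"
  by standard (auto intro!: ell2_eqI simp: algebra_simps)

instantiation ell2 :: (type) real_normed_vector
begin

definition norm_ell2 :: "'a ell2 \<Rightarrow> real"
  where "norm_ell2 f = sqrt (\<Sum>\<^sub>\<infinity>x. (cmod (coord f x))\<^sup>2)"

definition dist_ell2 :: "'a ell2 \<Rightarrow> 'a ell2 \<Rightarrow> real"
  where "dist_ell2 f g = norm (f - g)"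

definition sgn_ell2 :: "'a ell2 \<Rightarrow> 'a ell2"
  where "sgn_ell2 f = inverse (norm f) *\<^sub>R f"

definition uniformity_ell2 :: "('a ell2 \<times> 'a ell2) filter"
  where "uniformity_ell2 = (INF e\<in>{0<..}. principal {(x, y). dist x y < e})"

definition open_ell2 :: "'a ell2 set \<Rightarrow> bool"
  where "open_ell2 U \<longleftrightarrow> (\<forall>x\<in>U. eventually (\<lambda>(x', y). x' = x \<longrightarrow> y \<in> U) uniformity)"

lemma L2_set_le_norm_ell2:
  assumes "finite F"
  shows "L2_set (\<lambda>x. cmod (coord f x)) F \<le> norm f"
  unfolding norm_ell2_def L2_set_def
  using assms by (intro real_sqrt_le_mono finite_sum_le_infsum coord_sq_summable) auto

lemma norm_ell2_leI:
  assumes "\<And>F. finite F \<Longrightarrow> L2_set (\<lambda>x. cmod (coord f x)) F \<le> B"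
  shows "norm f \<le> B"
proof -
  have B: "0 \<le> B"
    using assms[of "{}"] by simp
  have "(\<Sum>\<^sub>\<infinity>x. (cmod (coord f x))\<^sup>2) \<le> B\<^sup>2"
  proof (rule infsum_le_finite_sums[OF coord_sq_summable])
    fix F :: "'a set" assume "finite F"
    then have "(L2_set (\<lambda>x. cmod (coord f x)) F)\<^sup>2 \<le> B\<^sup>2"
      by (intro power_mono assms) auto
    then show "(\<Sum>x\<in>F. (cmod (coord f x))\<^sup>2) \<le> B\<^sup>2"
      by (simp add: L2_set_def sum_nonneg)
  qed
  then show ?thesis
    unfolding norm_ell2_def using B by (simp add: real_le_lsqrt)
qed

lemma cmod_coord_le_norm: "cmod (coord f x) \<le> norm f"
  using L2_set_le_norm_ell2[of "{x}" f] by simp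

instance
proof
  fix f g :: "'a ell2" and r :: real
  show "dist f g = norm (f - g)"
    by (rule dist_ell2_def)
  show "sgn f = f /\<^sub>R norm f"
    by (rule sgn_ell2_def)
  show "uniformity = (INF e\<in>{0<..}. principal {(x, y :: 'a ell2). dist x y < e})"
    by (rule uniformity_ell2_def)
  show "open U = (\<forall>x\<in>U. \<forall>\<^sub>F (x', y) in uniformity. x' = x \<longrightarrow> y \<in> U)" for U :: "'a ell2 set"
    by (rule open_ell2_def)
  show "(norm f = 0) = (f = 0)"
  proof
    assume "norm f = 0"
    then have "coord f x = 0" for x
      using cmod_coord_le_norm[of f x] by simp
    then show "f = 0"
      by (intro ell2_eqI) simp
  qed (simp add: norm_ell2_def)
  show "norm (f + g) \<le> norm f + norm g"
  proof (rule norm_ell2_leI)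
    fix F :: "'a set" assume F: "finite F"
    have "L2_set (\<lambda>x. cmod (coord (f + g) x)) F
        \<le> L2_set (\<lambda>x. cmod (coord f x) + cmod (coord g x)) F"
      by (intro L2_set_mono) (auto intro: norm_triangle_ineq)
    also have "\<dots> \<le> L2_set (\<lambda>x. cmod (coord f x)) F + L2_set (\<lambda>x. cmod (coord g x)) F"
      by (rule L2_set_triangle_ineq)
    also have "\<dots> \<le> norm f + norm g"
      using F by (intro add_mono L2_set_le_norm_ell2)
    finally show "L2_set (\<lambda>x. cmod (coord (f + g) x)) F \<le> norm f + norm g" .
  qed
  have "(\<Sum>\<^sub>\<infinity>x. (cmod (coord (r *\<^sub>R f) x))\<^sup>2) = r\<^sup>2 * (\<Sum>\<^sub>\<infinity>x. (cmod (coord f x))\<^sup>2)"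
    by (simp add: norm_mult power_mult_distrib infsum_cmult_right')
  then show "norm (r *\<^sub>R f) = \<bar>r\<bar> * norm f"
    by (simp add: norm_ell2_def real_sqrt_mult)
qed

end

lemma norm_scaleC: "norm (c *\<^sub>C f) = cmod c * norm f"
proof -
  have "(\<Sum>\<^sub>\<infinity>x. (cmod (coord (c *\<^sub>C f) x))\<^sup>2) = (cmod c)\<^sup>2 * (\<Sum>\<^sub>\<infinity>x. (cmod (coord f x))\<^sup>2)"
    by (simp add: norm_mult power_mult_distrib infsum_cmult_right')
  then show ?thesis
    by (simp add: norm_ell2_def real_sqrt_mult)
qed

lift_definition chi :: "'a \<Rightarrow> 'a ell2" is "\<lambda>a x. if x = a then 1 else 0"
proof -
  fix a :: 'a
  have "(\<lambda>x. (cmod (if x = a then 1 else 0))\<^sup>2) summable_on {a}"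
    by simp
  then show "(\<lambda>x. (cmod (if x = a then 1 else 0))\<^sup>2) summable_on UNIV"
    by (rule summable_on_cong_neutral[THEN iffD1, rotated -1]) auto
qed

lemma coord_chi: "coord (chi a) x = (if x = a then 1 else 0)"
  by transfer simp

section \<open>Bounded operators on the space of families supported in a set\<close>

text \<open>
  The type \<open>'a \<Rightarrow>\<^sub>L 'b\<close> consists of real-linear maps, so complex linearity is imposed separately.
  The space \<open>\<ell>\<^sup>2(X)\<close> for a set \<open>X\<close> is the range of the coordinate projection \<open>proj X\<close>, and an
  operator on \<open>\<ell>\<^sup>2(X)\<close> is identified with its extension by zero to the orthogonal complement
  of \<open>\<ell>\<^sup>2(X)\<close>. This preserves sums, products and the operator norm; the identity operator of
  \<open>\<ell>\<^sup>2(X)\<close> becomes \<open>proj X\<close>.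
\<close>

type_synonym 'a oper = "'a ell2 \<Rightarrow>\<^sub>L 'a ell2"

lift_definition restrict_ell2 :: "'a set \<Rightarrow> 'a ell2 \<Rightarrow> 'a ell2"
  is "\<lambda>X f x. if x \<in> X then f x else 0"
  by (erule sq_summable_comparison) auto

lemma coord_restrict: "coord (restrict_ell2 X f) x = (if x \<in> X then coord f x else 0)"
  by transfer simp

lift_definition proj :: "'a set \<Rightarrow> 'a oper" is restrict_ell2
proof (rule bounded_linear_intro[where K = 1])
  fix X :: "'a set" and f :: "'a ell2"
  show "norm (restrict_ell2 X f) \<le> norm f * 1"
  proof (rule norm_ell2_leI)
    fix F :: "'a set" assume "finite F"
    have "L2_set (\<lambda>x. cmod (coord (restrict_ell2 X f) x)) F \<le> L2_set (\<lambda>x. cmod (coord f x)) F"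
      by (intro L2_set_mono) (auto simp: coord_restrict)
    also have "\<dots> \<le> norm f * 1"
      using L2_set_le_norm_ell2[OF \<open>finite F\<close>] by simp
    finally show "L2_set (\<lambda>x. cmod (coord (restrict_ell2 X f) x)) F \<le> norm f * 1" .
  qed
qed (auto intro!: ell2_eqI simp: coord_restrict)

lemma coord_proj: "coord (proj X f) x = (if x \<in> X then coord f x else 0)"
  by (simp add: proj.rep_eq coord_restrict)

definition bounded_operators :: "'a set \<Rightarrow> 'a oper set"
  where "bounded_operators X =
    {T. (\<forall>c f. blinfun_apply T (c *\<^sub>C f) = c *\<^sub>C blinfun_apply T f) \<and> proj X o\<^sub>L T = T \<and> T o\<^sub>L proj X = T}"

lemma chi_expansion:
  "((\<lambda>x. coord f x *\<^sub>C chi x) has_sum proj X f) X"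
proof -
  let ?s = "\<lambda>F. \<Sum>x\<in>F. (cmod (coord f x))\<^sup>2"
  let ?S = "\<Sum>\<^sub>\<infinity>x\<in>X. (cmod (coord f x))\<^sup>2"
  have norm_tail: "norm ((\<Sum>x\<in>F. coord f x *\<^sub>C chi x) - proj X f) = sqrt (?S - ?s F)"
    if F: "finite F" "F \<subseteq> X" for F
  proof -
    have "coord ((\<Sum>x\<in>F. coord f x *\<^sub>C chi x) - proj X f) y = (if y \<in> X - F then - coord f y else 0)"
      for y
    proof -
      have "(\<Sum>x\<in>F. coord f x * coord (chi x) y) = (\<Sum>x\<in>F. if y = x then coord f x else 0)"
        by (rule sum.cong) (auto simp: coord_chi)
      also have "\<dots> = (if y \<in> F then coord f y else 0)"
        using F(1) by simp
      finally show ?thesis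
        using F(2) by (auto simp: coord_proj)
    qed
    then have "norm ((\<Sum>x\<in>F. coord f x *\<^sub>C chi x) - proj X f)
        = sqrt (\<Sum>\<^sub>\<infinity>y. (cmod (if y \<in> X - F then - coord f y else 0))\<^sup>2)"
      by (simp only: norm_ell2_def)
    also have "(\<Sum>\<^sub>\<infinity>y. (cmod (if y \<in> X - F then - coord f y else 0))\<^sup>2)
        = (\<Sum>\<^sub>\<infinity>y\<in>X - F. (cmod (coord f y))\<^sup>2)"
      by (rule infsum_cong_neutral) auto
    also have "\<dots> = ?S - ?s F"
      using F by (subst infsum_Diff) (auto intro: coord_sq_summable)
    finally show ?thesis .
  qed
  have "(?s \<longlongrightarrow> ?S) (finite_subsets_at_top X)"
    using has_sum_infsum[OF coord_sq_summable] by (simp add: has_sum_def)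
  then have "((\<lambda>F. sqrt (?S - ?s F)) \<longlongrightarrow> sqrt (?S - ?S)) (finite_subsets_at_top X)"
    by (intro tendsto_intros)
  then have "((\<lambda>F. sqrt (?S - ?s F)) \<longlongrightarrow> 0) (finite_subsets_at_top X)"
    by simp
  then have "((\<lambda>F. norm ((\<Sum>x\<in>F. coord f x *\<^sub>C chi x) - proj X f)) \<longlongrightarrow> 0) (finite_subsets_at_top X)"
    by (rule Lim_transform_eventually)
       (rule eventually_finite_subsets_at_top_weakI, simp add: norm_tail)
  then show ?thesis
    by (simp add: has_sum_def tendsto_norm_zero_iff LIM_zero_iff)
qed

lemma weighted_shift_ex1:
  fixes g :: "'a \<Rightarrow> 'a" and w :: "'a \<Rightarrow> complex"
  assumes g: "inj_on g X" "g ` X \<subseteq> X" and w: "\<And>x. x \<in> X \<Longrightarrow> cmod (w x) = 1"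
  shows "\<exists>!T. T \<in> bounded_operators X \<and> (\<forall>x\<in>X. blinfun_apply T (chi x) = w x *\<^sub>C chi (g x))"
proof (rule ex_ex1I)
  define h where "h = inv_into X g"
  have h: "h (g x) = x" if "x \<in> X" for x
    using that g(1) by (simp add: h_def)
  define t where "t = (\<lambda>(f :: 'a ell2) y. if y \<in> g ` X then w (h y) * coord f (h y) else 0)"
  have fin: "L2_set (\<lambda>y. cmod (t f y)) F \<le> norm f" if "finite F" for f F
  proof -
    have "L2_set (\<lambda>y. cmod (t f y)) F = L2_set (\<lambda>y. cmod (t f y)) (F \<inter> g ` X)"
      unfolding L2_set_def using that
      by (intro arg_cong[of _ _ sqrt] sum.mono_neutral_right) (auto simp: t_def)
    also have "\<dots> = L2_set (\<lambda>y. cmod (coord f (h y))) (F \<inter> g ` X)"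
      by (rule L2_set_cong) (auto simp: t_def h w norm_mult)
    also have "\<dots> = L2_set (\<lambda>x. cmod (coord f x)) (h ` (F \<inter> g ` X))"
      unfolding L2_set_def by (subst sum.reindex) (auto simp: inj_on_def h)
    also have "\<dots> \<le> norm f"
      using that by (intro L2_set_le_norm_ell2) auto
    finally show ?thesis .
  qed
  have summ: "(\<lambda>y. (cmod (t f y))\<^sup>2) summable_on UNIV" for f
  proof (rule nonneg_bdd_above_summable_on)
    show "bdd_above (sum (\<lambda>y. (cmod (t f y))\<^sup>2) ` {F. F \<subseteq> UNIV \<and> finite F})"
    proof (rule bdd_aboveI2)
      fix F :: "'a set" assume "F \<in> {F. F \<subseteq> UNIV \<and> finite F}"
      then have "(L2_set (\<lambda>y. cmod (t f y)) F)\<^sup>2 \<le> (norm f)\<^sup>2"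
        by (intro power_mono fin) auto
      then show "(\<Sum>y\<in>F. (cmod (t f y))\<^sup>2) \<le> (norm f)\<^sup>2"
        by (simp add: L2_set_def sum_nonneg)
    qed
  qed auto
  have coord_t: "coord (Abs_ell2 (t f)) = t f" for f
    using summ by (simp add: Abs_ell2_inverse)
  have bl: "bounded_linear (\<lambda>f. Abs_ell2 (t f))"
  proof (rule bounded_linear_intro[where K = 1])
    show "norm (Abs_ell2 (t f)) \<le> norm f * 1" for f
      by (rule norm_ell2_leI) (simp add: coord_t fin)
  qed (rule ell2_eqI, simp add: coord_t, simp add: t_def algebra_simps)+
  have "Blinfun (\<lambda>f. Abs_ell2 (t f)) \<in> bounded_operators X"
    unfolding bounded_operators_def mem_Collect_eq
  proof (intro conjI allI blinfun_eqI ell2_eqI)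
    fix f :: "'a ell2" and c x
    show "coord (blinfun_apply (Blinfun (\<lambda>f. Abs_ell2 (t f))) (c *\<^sub>C f)) x
        = coord (c *\<^sub>C blinfun_apply (Blinfun (\<lambda>f. Abs_ell2 (t f))) f) x"
      by (simp add: bounded_linear_Blinfun_apply[OF bl] coord_t) (simp add: t_def)
    show "coord (blinfun_apply (proj X o\<^sub>L Blinfun (\<lambda>f. Abs_ell2 (t f))) f) x
        = coord (blinfun_apply (Blinfun (\<lambda>f. Abs_ell2 (t f))) f) x"
      using g(2) by (auto simp: bounded_linear_Blinfun_apply[OF bl] coord_t coord_proj) (auto simp: t_def)
    show "coord (blinfun_apply (Blinfun (\<lambda>f. Abs_ell2 (t f)) o\<^sub>L proj X) f) x
        = coord (blinfun_apply (Blinfun (\<lambda>f. Abs_ell2 (t f))) f) x"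
      by (simp add: bounded_linear_Blinfun_apply[OF bl] coord_t) (auto simp: t_def coord_proj h)
  qed
  moreover have "blinfun_apply (Blinfun (\<lambda>f. Abs_ell2 (t f))) (chi x) = w x *\<^sub>C chi (g x)"
    if "x \<in> X" for x
    unfolding bounded_linear_Blinfun_apply[OF bl]
    using that by (intro ell2_eqI, unfold coord_t) (auto simp: t_def coord_chi h)
  ultimately show "\<exists>T. T \<in> bounded_operators X \<and> (\<forall>x\<in>X. blinfun_apply T (chi x) = w x *\<^sub>C chi (g x))"
    by blast
next
  have expand: "((\<lambda>x. coord f x *\<^sub>C w x *\<^sub>C chi (g x)) has_sum blinfun_apply T f) X"
    if T: "T \<in> bounded_operators X \<and> (\<forall>x\<in>X. blinfun_apply T (chi x) = w x *\<^sub>C chi (g x))" for T f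
  proof -
    have "((\<lambda>x. blinfun_apply T (coord f x *\<^sub>C chi x)) has_sum blinfun_apply T (proj X f)) X"
      by (rule has_sum_bounded_linear[OF blinfun.bounded_linear_right chi_expansion, unfolded o_def])
    also have "blinfun_apply T (proj X f) = blinfun_apply (T o\<^sub>L proj X) f"
      by simp
    also have "T o\<^sub>L proj X = T"
      using T by (simp add: bounded_operators_def)
    finally show ?thesis
      by (rule has_sum_cong[THEN iffD1, rotated]) (use T in \<open>simp add: bounded_operators_def\<close>)
  qed
  fix T U
  assume "T \<in> bounded_operators X \<and> (\<forall>x\<in>X. blinfun_apply T (chi x) = w x *\<^sub>C chi (g x))"
    and "U \<in> bounded_operators X \<and> (\<forall>x\<in>X. blinfun_apply U (chi x) = w x *\<^sub>C chi (g x))"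
  then show "T = U"
    by (intro blinfun_eqI has_sum_unique[OF expand expand]) auto
qed

lemma bounded_linear_scaleC: "bounded_linear (\<lambda>f :: 'a ell2. c *\<^sub>C f)"
  by (rule bounded_linear_intro[where K = "cmod c"])
    (auto intro!: ell2_eqI simp: algebra_simps norm_scaleC)

definition scaleC_oper :: "complex \<Rightarrow> 'a oper \<Rightarrow> 'a oper" (infixr \<open>*\<^sub>O\<close> 75)
  where "c *\<^sub>O T = Blinfun (\<lambda>f. c *\<^sub>C T f)"

lemma scaleC_oper_apply [simp]: "(c *\<^sub>O T) f = c *\<^sub>C T f"
  unfolding scaleC_oper_def
  by (simp add: bounded_linear_Blinfun_apply bounded_linear_compose[OF bounded_linear_scaleC]
      blinfun.bounded_linear_right)

definition operator_algebra :: "'a oper set \<Rightarrow> bool"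
  where "operator_algebra M \<longleftrightarrow>
    (\<forall>T\<in>M. \<forall>U\<in>M. T + U \<in> M \<and> T o\<^sub>L U \<in> M) \<and> (\<forall>c. \<forall>T\<in>M. c *\<^sub>O T \<in> M)"

section \<open>The universal model\<close>

text \<open>
  A word in the free semigroup with generators \<open>g\<^sub>1, \<dots>, g\<^sub>m\<close> is the list of its letters' indices in
  \<open>{1..m}\<close>; the neutral element is the empty list.
\<close>

type_synonym word_tuple = "nat \<Rightarrow> nat list"

type_synonym coeff_family = "nat \<Rightarrow> nat \<Rightarrow> nat \<Rightarrow> nat \<Rightarrow> complex"

definition words :: "nat \<Rightarrow> (nat \<Rightarrow> nat) \<Rightarrow> word_tuple set"
  where "words k n = (\<Pi>\<^sub>E i\<in>{1..k}. lists {1..n i})"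

definition wlen :: "nat \<Rightarrow> word_tuple \<Rightarrow> nat"
  where "wlen k \<beta> = (\<Sum>i=1..k. length (\<beta> i))"

text \<open>The entry \<open>\<lambda>\<^sub>i\<^sub>,\<^sub>j(s,t)\<close> is written \<open>lam i j s t\<close>.\<close>

definition word_coeff :: "coeff_family \<Rightarrow> nat \<Rightarrow> nat \<Rightarrow> nat \<Rightarrow> nat list \<Rightarrow> complex"
  where "word_coeff lam i j s \<beta> = (\<Prod>t\<leftarrow>\<beta>. lam i j s t)"

definition shift ::
    "nat \<Rightarrow> (nat \<Rightarrow> nat) \<Rightarrow> coeff_family \<Rightarrow> nat \<Rightarrow> nat \<Rightarrow> word_tuple oper"
  where "shift k n lam i s = (THE T. T \<in> bounded_operators (words k n) \<and>
    (\<forall>\<alpha>\<in>words k n. blinfun_apply T (chi \<alpha>) =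
      (\<Prod>j\<in>{1..<i}. word_coeff lam i j s (\<alpha> j)) *\<^sub>C chi (\<alpha>(i := s # \<alpha> i))))"

lemma word_coeff_unimodular:
  assumes "\<And>t. t \<in> {1..n j} \<Longrightarrow> cmod (lam i j s t) = 1" "\<beta> \<in> lists {1..n j}"
  shows "cmod (word_coeff lam i j s \<beta>) = 1"
  using assms(2) unfolding word_coeff_def
  by (induction \<beta>) (auto simp: norm_mult assms(1))

lemma words_mem: "\<alpha> \<in> words k n \<Longrightarrow> i \<in> {1..k} \<Longrightarrow> \<alpha> i \<in> lists {1..n i}"
  unfolding words_def by (rule PiE_mem)

lemma words_update:
  assumes "\<alpha> \<in> words k n" "i \<in> {1..k}" "w \<in> lists {1..n i}"
  shows "\<alpha>(i := w) \<in> words k n"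
  using assms unfolding words_def by (auto simp: PiE_iff extensional_def)

text \<open>The defining property of \<open>shift\<close> is satisfied by exactly one operator.\<close>

lemma shift_props:
  assumes lam: "\<And>i j s t. \<lbrakk>i \<in> {1..k}; j \<in> {1..k}; i \<noteq> j; s \<in> {1..n i}; t \<in> {1..n j}\<rbrakk>
      \<Longrightarrow> cmod (lam i j s t) = 1"
    and idx: "i \<in> {1..k}" "s \<in> {1..n i}"
  shows "shift k n lam i s \<in> bounded_operators (words k n)"
    and "\<alpha> \<in> words k n \<Longrightarrow> shift k n lam i s (chi \<alpha>) =
      (\<Prod>j\<in>{1..<i}. word_coeff lam i j s (\<alpha> j)) *\<^sub>C chi (\<alpha>(i := s # \<alpha> i))"
    and "\<alpha> \<in> words k n \<Longrightarrow> cmod (\<Prod>j\<in>{1..<i}. word_coeff lam i j s (\<alpha> j)) = 1"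
proof -
  have w: "cmod (\<Prod>j\<in>{1..<i}. word_coeff lam i j s (\<alpha> j)) = 1" if "\<alpha> \<in> words k n" for \<alpha>
    unfolding prod_norm[symmetric]
  proof (intro prod.neutral ballI)
    fix j assume j: "j \<in> {1..<i}"
    then have "\<alpha> j \<in> lists {1..n j}"
      using that idx by (intro words_mem) auto
    moreover have "cmod (lam i j s t) = 1" if "t \<in> {1..n j}" for t
      using j idx that by (intro lam) auto
    ultimately show "cmod (word_coeff lam i j s (\<alpha> j)) = 1"
      by (intro word_coeff_unimodular[of n])
  qed
  then show "\<alpha> \<in> words k n \<Longrightarrow> cmod (\<Prod>j\<in>{1..<i}. word_coeff lam i j s (\<alpha> j)) = 1"
    by blast
  have inj: "inj_on (\<lambda>\<alpha>. \<alpha>(i := s # \<alpha> i)) (words k n)"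
  proof (rule inj_onI)
    fix \<alpha> \<beta> :: word_tuple
    assume eq: "\<alpha>(i := s # \<alpha> i) = \<beta>(i := s # \<beta> i)"
    have "\<alpha> j = \<beta> j" for j
      using fun_cong[OF eq, of j] by (cases "j = i") auto
    then show "\<alpha> = \<beta>" by blast
  qed
  have sub: "(\<lambda>\<alpha>. \<alpha>(i := s # \<alpha> i)) ` words k n \<subseteq> words k n"
  proof (rule image_subsetI)
    fix \<alpha> assume \<alpha>: "\<alpha> \<in> words k n"
    then show "\<alpha>(i := s # \<alpha> i) \<in> words k n"
      using idx words_mem[OF \<alpha> idx(1)] by (intro words_update) auto
  qed
  have "shift k n lam i s \<in> bounded_operators (words k n) \<and>
    (\<forall>\<alpha>\<in>words k n. shift k n lam i s (chi \<alpha>) =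
      (\<Prod>j\<in>{1..<i}. word_coeff lam i j s (\<alpha> j)) *\<^sub>C chi (\<alpha>(i := s # \<alpha> i)))"
    unfolding shift_def by (rule theI'[OF weighted_shift_ex1[OF inj sub w]])
  then show "shift k n lam i s \<in> bounded_operators (words k n)"
    and "\<alpha> \<in> words k n \<Longrightarrow> shift k n lam i s (chi \<alpha>) =
      (\<Prod>j\<in>{1..<i}. word_coeff lam i j s (\<alpha> j)) *\<^sub>C chi (\<alpha>(i := s # \<alpha> i))"
    by blast+
qed

definition shift_word ::
    "nat \<Rightarrow> (nat \<Rightarrow> nat) \<Rightarrow> coeff_family \<Rightarrow> nat \<Rightarrow> nat list \<Rightarrow> word_tuple oper"
  where "shift_word k n lam i \<alpha> =
    foldr (\<lambda>s T. shift k n lam i s o\<^sub>L T) \<alpha> (proj (words k n))"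

definition shift_tuple ::
    "nat \<Rightarrow> (nat \<Rightarrow> nat) \<Rightarrow> coeff_family \<Rightarrow> word_tuple \<Rightarrow> word_tuple oper"
  where "shift_tuple k n lam \<beta> =
    foldr (\<lambda>i T. shift_word k n lam i (\<beta> i) o\<^sub>L T) [1..<Suc k] (proj (words k n))"

definition poly_algebra ::
    "nat \<Rightarrow> (nat \<Rightarrow> nat) \<Rightarrow> coeff_family \<Rightarrow> word_tuple oper set"
  where "poly_algebra k n lam = (\<lambda>M. closed M \<and> operator_algebra M) hull
    (insert (proj (words k n)) {shift k n lam i s | i s. i \<in> {1..k} \<and> s \<in> {1..n i}})"

section \<open>The noncommutative Hardy space\<close>

definition polys :: "nat \<Rightarrow> (nat \<Rightarrow> nat) \<Rightarrow> word_tuple ell2 set"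
  where "polys k n = ell2.span (chi ` words k n)"

definition series_chi ::
    "nat \<Rightarrow> (nat \<Rightarrow> nat) \<Rightarrow> coeff_family \<Rightarrow> (word_tuple \<Rightarrow> complex) \<Rightarrow>
      word_tuple \<Rightarrow> word_tuple ell2"
  where "series_chi k n lam c \<gamma> = (\<Sum>\<^sub>\<infinity>\<beta>\<in>words k n. c \<beta> *\<^sub>C shift_tuple k n lam \<beta> (chi \<gamma>))"

definition series_poly ::
    "nat \<Rightarrow> (nat \<Rightarrow> nat) \<Rightarrow> coeff_family \<Rightarrow> (word_tuple \<Rightarrow> complex) \<Rightarrow>
      word_tuple ell2 \<Rightarrow> word_tuple ell2"
  where "series_poly k n lam c p = (\<Sum>\<gamma> | coord p \<gamma> \<noteq> 0. coord p \<gamma> *\<^sub>C series_chi k n lam c \<gamma>)"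

definition fourier_rep ::
    "nat \<Rightarrow> (nat \<Rightarrow> nat) \<Rightarrow> coeff_family \<Rightarrow> (word_tuple \<Rightarrow> complex) \<Rightarrow>
      word_tuple oper \<Rightarrow> bool"
  where "fourier_rep k n lam c A \<longleftrightarrow>
    (\<lambda>\<beta>. (cmod (c \<beta>))\<^sup>2) summable_on words k n \<and>
    bdd_above {norm (series_poly k n lam c p) | p. p \<in> polys k n \<and> norm p \<le> 1} \<and>
    A \<in> bounded_operators (words k n) \<and>
    (\<forall>p\<in>polys k n. A p = series_poly k n lam c p)"

definition hardy_algebra ::
    "nat \<Rightarrow> (nat \<Rightarrow> nat) \<Rightarrow> coeff_family \<Rightarrow> word_tuple oper set"
  where "hardy_algebra k n lam = {A. \<exists>c. fourier_rep k n lam c A}"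

definition homogeneous_part ::
    "nat \<Rightarrow> (nat \<Rightarrow> nat) \<Rightarrow> coeff_family \<Rightarrow> (word_tuple \<Rightarrow> complex) \<Rightarrow>
      real \<Rightarrow> nat \<Rightarrow> word_tuple oper"
  where "homogeneous_part k n lam c r p =
    (\<Sum>\<beta> | \<beta> \<in> words k n \<and> wlen k \<beta> = p. (complex_of_real (r ^ p) * c \<beta>) *\<^sub>O shift_tuple k n lam \<beta>)"

definition dilated_series ::
    "nat \<Rightarrow> (nat \<Rightarrow> nat) \<Rightarrow> coeff_family \<Rightarrow> (word_tuple \<Rightarrow> complex) \<Rightarrow>
      real \<Rightarrow> word_tuple oper"
  where "dilated_series k n lam c r = (\<Sum>p. homogeneous_part k n lam c r p)"

text \<open>The series defining \<open>series_chi\<close> converges, and the sum in \<open>homogeneous_part\<close> is finite.\<close>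

lemma shift_word_chi:
  assumes lam: "\<And>i j s t. \<lbrakk>i \<in> {1..k}; j \<in> {1..k}; i \<noteq> j; s \<in> {1..n i}; t \<in> {1..n j}\<rbrakk>
      \<Longrightarrow> cmod (lam i j s t) = 1"
    and i: "i \<in> {1..k}" and w: "w \<in> lists {1..n i}" and \<gamma>: "\<gamma> \<in> words k n"
  shows "\<exists>u. cmod u = 1 \<and> shift_word k n lam i w (chi \<gamma>) = u *\<^sub>C chi (\<gamma>(i := w @ \<gamma> i))"
  using w
proof (induction w)
  case Nil
  have "proj (words k n) (chi \<gamma>) = chi \<gamma>"
    using \<gamma> by (intro ell2_eqI) (auto simp: coord_proj coord_chi)
  then show ?case
    by (intro exI[of _ 1]) (simp add: shift_word_def)
next
  case (Cons s w)
  from Cons.IH obtain u where u: "cmod u = 1"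
      "shift_word k n lam i w (chi \<gamma>) = u *\<^sub>C chi (\<gamma>(i := w @ \<gamma> i))"
    by blast
  have s: "s \<in> {1..n i}"
    using Cons by auto
  have mem: "\<gamma>(i := w @ \<gamma> i) \<in> words k n"
    using Cons i \<gamma> words_mem[OF \<gamma> i] by (intro words_update) auto
  have S: "shift k n lam i s (c *\<^sub>C f) = c *\<^sub>C shift k n lam i s f" for c f
    using shift_props(1)[of k n lam, OF lam i s] by (simp add: bounded_operators_def)
  let ?v = "\<Prod>j\<in>{1..<i}. word_coeff lam i j s ((\<gamma>(i := w @ \<gamma> i)) j)"
  have "shift_word k n lam i (s # w) (chi \<gamma>) = shift k n lam i s (shift_word k n lam i w (chi \<gamma>))"
    by (simp add: shift_word_def)
  also have "\<dots> = u *\<^sub>C ?v *\<^sub>C chi ((\<gamma>(i := w @ \<gamma> i))(i := s # (\<gamma>(i := w @ \<gamma> i)) i))"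
    unfolding u(2) S using shift_props(2)[of k n lam, OF lam i s mem] by simp
  also have "\<dots> = (u * ?v) *\<^sub>C chi (\<gamma>(i := (s # w) @ \<gamma> i))"
    by simp
  finally show ?case
    using u(1) shift_props(3)[of k n lam, OF lam i s mem] by (intro exI[of _ "u * ?v"]) (simp add: norm_mult fun_upd_def)
qed

lemma shift_word_scaleC:
  assumes lam: "\<And>i j s t. \<lbrakk>i \<in> {1..k}; j \<in> {1..k}; i \<noteq> j; s \<in> {1..n i}; t \<in> {1..n j}\<rbrakk>
      \<Longrightarrow> cmod (lam i j s t) = 1"
    and i: "i \<in> {1..k}" and w: "w \<in> lists {1..n i}"
  shows "shift_word k n lam i w (c *\<^sub>C f) = c *\<^sub>C shift_word k n lam i w f"
  using w
proof (induction w)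
  case Nil
  show ?case
    by (intro ell2_eqI) (simp add: shift_word_def coord_proj)
next
  case (Cons s w)
  then have "s \<in> {1..n i}" by auto
  then show ?case
    using Cons shift_props(1)[of k n lam, OF lam i] by (simp add: shift_word_def bounded_operators_def)
qed

lemma shift_tuple_chi:
  assumes lam: "\<And>i j s t. \<lbrakk>i \<in> {1..k}; j \<in> {1..k}; i \<noteq> j; s \<in> {1..n i}; t \<in> {1..n j}\<rbrakk>
      \<Longrightarrow> cmod (lam i j s t) = 1"
    and \<beta>: "\<beta> \<in> words k n" and \<gamma>: "\<gamma> \<in> words k n"
  shows "\<exists>u. cmod u = 1 \<and> shift_tuple k n lam \<beta> (chi \<gamma>) =
    u *\<^sub>C chi (\<lambda>i. if i \<in> {1..k} then \<beta> i @ \<gamma> i else \<gamma> i)"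
proof -
  have "\<exists>u. cmod u = 1 \<and>
      foldr (\<lambda>i T. shift_word k n lam i (\<beta> i) o\<^sub>L T) js (proj (words k n)) (chi \<gamma>) =
      u *\<^sub>C chi (\<lambda>i. if i \<in> set js then \<beta> i @ \<gamma> i else \<gamma> i)"
    if "set js \<subseteq> {1..k}" "distinct js" for js
    using that
  proof (induction js)
    case Nil
    have "proj (words k n) (chi \<gamma>) = chi \<gamma>"
      using \<gamma> by (intro ell2_eqI) (auto simp: coord_proj coord_chi)
    then show ?case
      by (intro exI[of _ 1]) simp
  next
    case (Cons i js)
    let ?\<delta> = "\<lambda>j. if j \<in> set js then \<beta> j @ \<gamma> j else \<gamma> j"
    obtain u where u: "cmod u = 1"
      "foldr (\<lambda>i T. shift_word k n lam i (\<beta> i) o\<^sub>L T) js (proj (words k n)) (chi \<gamma>) = u *\<^sub>C chi ?\<delta>"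
      using Cons by auto
    have i: "i \<in> {1..k}" "i \<notin> set js"
      using Cons by auto
    have \<beta>i: "\<beta> i \<in> lists {1..n i}"
      using \<beta> i(1) by (rule words_mem)
    have \<delta>: "?\<delta> \<in> words k n"
      using \<beta> \<gamma> Cons.prems(1) by (auto simp: words_def PiE_iff extensional_def)
    obtain v where v: "cmod v = 1"
      "shift_word k n lam i (\<beta> i) (chi ?\<delta>) = v *\<^sub>C chi (?\<delta>(i := \<beta> i @ ?\<delta> i))"
      using shift_word_chi[of k n lam, OF lam i(1) \<beta>i \<delta>] by blast
    have "?\<delta>(i := \<beta> i @ ?\<delta> i) = (\<lambda>j. if j \<in> set (i # js) then \<beta> j @ \<gamma> j else \<gamma> j)"
      using i(2) by auto
    then show ?case
      using u v shift_word_scaleC[of k n lam, OF lam i(1) \<beta>i]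
      by (intro exI[of _ "u * v"]) (simp add: norm_mult)
  qed
  from this[of "[1..<Suc k]"] show ?thesis
    unfolding shift_tuple_def by (simp add: atLeastLessThanSuc_atLeastAtMost del: upt_Suc)
qed

lemma series_chi_summable:
  assumes lam: "\<And>i j s t. \<lbrakk>i \<in> {1..k}; j \<in> {1..k}; i \<noteq> j; s \<in> {1..n i}; t \<in> {1..n j}\<rbrakk>
      \<Longrightarrow> cmod (lam i j s t) = 1"
    and c: "(\<lambda>\<beta>. (cmod (c \<beta>))\<^sup>2) summable_on words k n" and \<gamma>: "\<gamma> \<in> words k n"
  shows "(\<lambda>\<beta>. c \<beta> *\<^sub>C shift_tuple k n lam \<beta> (chi \<gamma>)) summable_on words k n"
proof -
  define m where "m = (\<lambda>\<beta> :: word_tuple. \<lambda>i. if i \<in> {1..k} then \<beta> i @ \<gamma> i else \<gamma> i)"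
  have "\<forall>\<beta>\<in>words k n. \<exists>u. cmod u = 1 \<and> shift_tuple k n lam \<beta> (chi \<gamma>) = u *\<^sub>C chi (m \<beta>)"
    unfolding m_def using shift_tuple_chi[of k n lam, OF lam _ \<gamma>] by blast
  from bchoice[OF this] obtain u where u: "\<And>\<beta>. \<beta> \<in> words k n \<Longrightarrow> cmod (u \<beta>) = 1"
    "\<And>\<beta>. \<beta> \<in> words k n \<Longrightarrow> shift_tuple k n lam \<beta> (chi \<gamma>) = u \<beta> *\<^sub>C chi (m \<beta>)"
    by blast
  have inj: "inj_on m (words k n)"
  proof (rule inj_onI)
    fix \<alpha> \<beta> assume mem: "\<alpha> \<in> words k n" "\<beta> \<in> words k n" and eq: "m \<alpha> = m \<beta>"
    show "\<alpha> = \<beta>"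
    proof (rule PiE_ext[OF mem[unfolded words_def]])
      fix i assume "i \<in> {1..k}"
      then show "\<alpha> i = \<beta> i"
        using fun_cong[OF eq, of i] by (simp add: m_def)
    qed
  qed
  define h where "h = inv_into (words k n) m"
  have h: "h (m \<beta>) = \<beta>" if "\<beta> \<in> words k n" for \<beta>
    using inj that by (simp add: h_def)
  define a where "a = (\<lambda>y. if y \<in> m ` words k n then c (h y) * u (h y) else 0)"
  have "(\<lambda>y. (cmod (a y))\<^sup>2) summable_on m ` words k n"
    unfolding summable_on_reindex[OF inj] o_def
    by (rule summable_on_cong[THEN iffD1, OF _ c]) (auto simp: a_def h u norm_mult)
  then have "(\<lambda>y. (cmod (a y))\<^sup>2) summable_on UNIV"
    by (rule summable_on_cong_neutral[THEN iffD1, rotated -1]) (auto simp: a_def)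
  then have coord_a: "coord (Abs_ell2 a) = a"
    by (simp add: Abs_ell2_inverse)
  have "(\<lambda>y. a y *\<^sub>C chi y) summable_on m ` words k n"
    using chi_expansion[of "Abs_ell2 a" "m ` words k n"] unfolding coord_a summable_on_def by blast
  then show ?thesis
    unfolding summable_on_reindex[OF inj] o_def
    by (rule summable_on_cong[THEN iffD1, rotated]) (auto simp: a_def h u)
qed

lemma finite_words_of_length: "finite {\<beta>. \<beta> \<in> words k n \<and> wlen k \<beta> = p}"
proof (rule finite_subset)
  show "{\<beta>. \<beta> \<in> words k n \<and> wlen k \<beta> = p}
      \<subseteq> (\<Pi>\<^sub>E i\<in>{1..k}. {w. set w \<subseteq> {1..n i} \<and> length w \<le> p})"
  proof
    fix \<beta> assume "\<beta> \<in> {\<beta>. \<beta> \<in> words k n \<and> wlen k \<beta> = p}"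
    then have \<beta>: "\<beta> \<in> words k n" and p: "(\<Sum>i=1..k. length (\<beta> i)) = p"
      by (auto simp: wlen_def)
    have "length (\<beta> i) \<le> p" if "i \<in> {1..k}" for i
      using member_le_sum[of i "{1..k}" "\<lambda>i. length (\<beta> i)"] that p by simp
    then show "\<beta> \<in> (\<Pi>\<^sub>E i\<in>{1..k}. {w. set w \<subseteq> {1..n i} \<and> length w \<le> p})"
      using \<beta> by (auto simp: words_def PiE_iff)
  qed
  show "finite (\<Pi>\<^sub>E i\<in>{1..k}. {w. set w \<subseteq> {1..n i} \<and> length w \<le> p})"
    by (intro finite_PiE finite_lists_length_le) auto
qed

end

theory Submission
  imports Defs
begin

text \<open>
  Grade the basis by \<open>|\<alpha>|\<close>, and let \<open>P\<^sub>m\<close> be the projection onto degree \<open>m\<close>. The homogeneous part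
  of degree \<open>p\<close> of the Fourier series is \<open>\<Sum>\<^sub>m P\<^sub>m\<^sub>+\<^sub>p A P\<^sub>m\<close>, so its norm is at most \<open>\<parallel>A\<parallel>\<close> and the
  dilated series converges in norm. Since \<open>A\<close> is lower triangular for the grading, the dilated
  operator arises from \<open>A\<close> by the Schur multiplier \<open>r\<^bsup>\<bar>a - b\<bar>\<^esup>\<close> on the block of degrees \<open>(a, b)\<close>. This
  matrix is positive definite with unit diagonal; its Cholesky factorization is explicit and writes
  the dilated operator as \<open>\<Sum>\<^sub>m D\<^sub>m A D\<^sub>m\<close> with diagonal \<open>D\<^sub>m\<close> and \<open>\<Sum>\<^sub>m D\<^sub>m\<^sup>2 = I\<close>, so its norm is at most
  \<open>\<parallel>A\<parallel>\<close>. Dominated convergence on basis vectors then gives the strong limit, and lower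
  semicontinuity of the norm the remaining inequality.
\<close>

section \<open>Square-summable families\<close>

lemma bounded_linear_coord: "bounded_linear (\<lambda>f. coord f x)"
  by (rule bounded_linear_intro[where K = 1]) (auto simp: cmod_coord_le_norm scaleR_conv_of_real)

lemma L2_set_power2: "(L2_set f F)\<^sup>2 = (\<Sum>x\<in>F. (f x)\<^sup>2)"
  by (simp add: L2_set_def sum_nonneg)

lemma sq_summable_if_L2_set_bounded:
  fixes f :: "'a \<Rightarrow> complex"
  assumes "\<And>F. finite F \<Longrightarrow> L2_set (\<lambda>x. cmod (f x)) F \<le> B"
  shows "(\<lambda>x. (cmod (f x))\<^sup>2) summable_on UNIV"
proof (rule nonneg_bdd_above_summable_on)
  show "bdd_above (sum (\<lambda>x. (cmod (f x))\<^sup>2) ` {F. F \<subseteq> UNIV \<and> finite F})"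
  proof (rule bdd_aboveI2)
    fix F :: "'a set" assume "F \<in> {F. F \<subseteq> UNIV \<and> finite F}"
    then have "(L2_set (\<lambda>x. cmod (f x)) F)\<^sup>2 \<le> B\<^sup>2"
      by (intro power_mono assms) auto
    then show "(\<Sum>x\<in>F. (cmod (f x))\<^sup>2) \<le> B\<^sup>2"
      by (simp add: L2_set_power2)
  qed
qed auto

text \<open>Completeness passes to the operators, so a geometric majorant will give norm convergence
  of the dilated series. The limit is taken coordinatewise.\<close>

instance ell2 :: (type) banach
proof
  fix X :: "nat \<Rightarrow> 'a ell2"
  assume X: "Cauchy X"
  define g where "g = (\<lambda>x. lim (\<lambda>n. coord (X n) x))"
  have lim: "(\<lambda>n. coord (X n) x) \<longlonglongrightarrow> g x" for x
    unfolding g_def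
    using bounded_linear.Cauchy[OF bounded_linear_coord X, of x]
    by (simp add: Cauchy_convergent flip: convergent_LIMSEQ_iff)
  \<comment> \<open>\<open>N\<close> must not depend on \<open>F\<close>: the bound uniform over
    finite sets stands in for a norm bound, since \<open>g\<close> is not yet known to be
    square-summable.\<close>
  have tail: "\<exists>N. \<forall>m\<ge>N. \<forall>F. finite F \<longrightarrow> L2_set (\<lambda>x. cmod (coord (X m) x - g x)) F \<le> e"
    if "e > 0" for e
  proof -
    obtain N where N: "\<And>m n. m \<ge> N \<Longrightarrow> n \<ge> N \<Longrightarrow> norm (X m - X n) < e"
      using X \<open>e > 0\<close> by (meson CauchyD)
    have "L2_set (\<lambda>x. cmod (coord (X m) x - g x)) F \<le> e" if "m \<ge> N" "finite F" for m F
    proof (rule tendsto_upperbound)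
      show "(\<lambda>n. L2_set (\<lambda>x. cmod (coord (X m) x - coord (X n) x)) F)
          \<longlonglongrightarrow> L2_set (\<lambda>x. cmod (coord (X m) x - g x)) F"
        unfolding L2_set_def by (intro tendsto_intros lim)
      show "\<forall>\<^sub>F n in sequentially. L2_set (\<lambda>x. cmod (coord (X m) x - coord (X n) x)) F \<le> e"
        using eventually_ge_at_top[of N]
      proof eventually_elim
        case (elim n)
        have "L2_set (\<lambda>x. cmod (coord (X m - X n) x)) F \<le> norm (X m - X n)"
          using \<open>finite F\<close> by (rule L2_set_le_norm_ell2)
        also have "\<dots> \<le> e"
          using N[OF \<open>m \<ge> N\<close> elim] by simp
        finally show ?case
          by simp
      qed
    qed simp
    then show ?thesis
      by blast
  qed
  \<comment> \<open>One index at distance at most 1 suffices to place \<open>g\<close> in the space,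
    as the sum of \<open>g - X N\<close> and \<open>X N\<close>.\<close>
  obtain N where N: "\<And>F. finite F \<Longrightarrow> L2_set (\<lambda>x. cmod (coord (X N) x - g x)) F \<le> 1"
    using tail[of 1] by auto
  have "(\<lambda>x. (cmod (coord (X N) x - g x))\<^sup>2) summable_on UNIV"
    using N by (rule sq_summable_if_L2_set_bounded)
  then have "(\<lambda>x. (cmod (g x - coord (X N) x))\<^sup>2) summable_on UNIV"
    by (simp add: norm_minus_commute)
  from sq_summable_add[OF this coord_sq_summable[of "X N"]]
  have "(\<lambda>x. (cmod (g x))\<^sup>2) summable_on UNIV"
    by simp
  then have g: "coord (Abs_ell2 g) = g"
    by (simp add: Abs_ell2_inverse)
  have "X \<longlonglongrightarrow> Abs_ell2 g"
  proof (rule LIMSEQ_I)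
    fix e :: real assume "e > 0"
    then obtain M where M: "\<And>m F. m \<ge> M \<Longrightarrow> finite F \<Longrightarrow>
        L2_set (\<lambda>x. cmod (coord (X m) x - g x)) F \<le> e / 2"
      using tail[of "e / 2"] by auto
    have "norm (X m - Abs_ell2 g) \<le> e / 2" if "m \<ge> M" for m
      by (rule norm_ell2_leI) (simp only: coord_simps g M that)
    then show "\<exists>no. \<forall>m\<ge>no. norm (X m - Abs_ell2 g) < e"
      using \<open>e > 0\<close> by (intro exI[of _ M]) force
  qed
  then show "convergent X"
    by (rule convergentI)
qed

section \<open>Finite combinations of basis vectors and dominated convergence\<close>

lemma coord_sum_chi:
  assumes "finite F"
  shows "coord (\<Sum>x\<in>F. w x *\<^sub>C chi x) y = (if y \<in> F then w y else 0)"
proof -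
  have "coord (\<Sum>x\<in>F. w x *\<^sub>C chi x) y = (\<Sum>x\<in>F. if y = x then w x else 0)"
    by (simp add: coord_chi if_distrib cong: if_cong)
  then show ?thesis
    using assms by simp
qed

lemma norm_sum_chi:
  assumes "finite F"
  shows "(norm (\<Sum>x\<in>F. w x *\<^sub>C chi x))\<^sup>2 = (\<Sum>x\<in>F. (cmod (w x))\<^sup>2)"
proof -
  let ?f = "\<lambda>y. coord (\<Sum>x\<in>F. w x *\<^sub>C chi x) y"
  have "(\<Sum>\<^sub>\<infinity>y. (cmod (?f y))\<^sup>2) = (\<Sum>\<^sub>\<infinity>y\<in>F. (cmod (w y))\<^sup>2)"
    by (rule infsum_cong_neutral) (auto simp: coord_sum_chi[OF assms] simp del: coord_sum)
  then show ?thesis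
    unfolding norm_ell2_def using assms by (simp add: sum_nonneg)
qed

lemma norm_chi: "norm (chi x) = 1"
  using norm_sum_chi[of "{x}" "\<lambda>_. 1"] by (simp add: abs_square_eq_1)

lemma norm_le_norm_ell2:
  assumes "\<And>x. cmod (coord f x) \<le> cmod (coord g x)"
  shows "norm f \<le> norm g"
proof (rule norm_ell2_leI)
  fix F :: "'a set" assume "finite F"
  have "L2_set (\<lambda>x. cmod (coord f x)) F \<le> L2_set (\<lambda>x. cmod (coord g x)) F"
    using assms by (intro L2_set_mono) auto
  also have "\<dots> \<le> norm g"
    using \<open>finite F\<close> by (rule L2_set_le_norm_ell2)
  finally show "L2_set (\<lambda>x. cmod (coord f x)) F \<le> norm g" .
qed

lemma norm_proj_le: "norm (proj X f) \<le> norm f"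
  by (rule norm_le_norm_ell2) (simp add: coord_proj)

lemma sum_chi_approximation:
  assumes "e > 0"
  obtains F where "finite F" "F \<subseteq> X" "norm (proj X f - (\<Sum>x\<in>F. coord f x *\<^sub>C chi x)) < e"
proof -
  have "\<forall>\<^sub>F F in finite_subsets_at_top X. dist (\<Sum>x\<in>F. coord f x *\<^sub>C chi x) (proj X f) < e"
    using chi_expansion[of f X] assms by (simp add: has_sum_def tendsto_iff)
  then obtain F where "finite F" "F \<subseteq> X" "dist (\<Sum>x\<in>F. coord f x *\<^sub>C chi x) (proj X f) < e"
    unfolding eventually_finite_subsets_at_top by blast
  then show ?thesis
    by (intro that) (auto simp: dist_norm norm_minus_commute)
qed

text \<open>Outside a suitable finite \<open>F\<close> the vector \<open>g\<close> has norm below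
  \<open>e / 4\<close>, and by domination so does \<open>h r\<close>. On \<open>F\<close>
  coordinatewise convergence leaves less than \<open>e / 2\<close>.\<close>

lemma tendsto_ell2_dominated:
  fixes h :: "'b \<Rightarrow> 'a ell2"
  assumes dom: "\<forall>\<^sub>F r in G. \<forall>x. cmod (coord (h r) x) \<le> cmod (coord g x)"
    and lim: "\<And>x. ((\<lambda>r. coord (h r) x) \<longlongrightarrow> coord g x) G"
  shows "(h \<longlongrightarrow> g) G"
proof (rule tendstoI)
  fix e :: real assume "e > 0"
  then obtain F where F: "finite F" "norm (proj UNIV g - (\<Sum>x\<in>F. coord g x *\<^sub>C chi x)) < e / 4"
    using sum_chi_approximation[of "e / 4" UNIV g] by auto
  have "proj UNIV g - (\<Sum>x\<in>F. coord g x *\<^sub>C chi x) = proj (- F) g"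
    by (rule ell2_eqI) (simp add: coord_proj coord_sum_chi[OF F(1)] del: coord_sum)
  with F(2) have g: "norm (proj (- F) g) < e / 4"
    by simp
  have "((\<lambda>r. \<Sum>x\<in>F. cmod (coord (h r) x - coord g x)) \<longlongrightarrow> (\<Sum>x\<in>F. cmod (coord g x - coord g x))) G"
    by (intro tendsto_intros lim)
  then have "((\<lambda>r. \<Sum>x\<in>F. cmod (coord (h r) x - coord g x)) \<longlongrightarrow> 0) G"
    by simp
  then have "\<forall>\<^sub>F r in G. (\<Sum>x\<in>F. cmod (coord (h r) x - coord g x)) < e / 2"
    using \<open>e > 0\<close> by (intro order_tendstoD) auto
  with dom show "\<forall>\<^sub>F r in G. dist (h r) g < e"
  proof eventually_elim
    case (elim r)
    have eq: "h r - g = (\<Sum>x\<in>F. (coord (h r) x - coord g x) *\<^sub>C chi x) + (proj (- F) (h r) - proj (- F) g)"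
      by (rule ell2_eqI) (simp add: coord_proj coord_sum_chi[OF F(1)] del: coord_sum)
    have "norm (\<Sum>x\<in>F. (coord (h r) x - coord g x) *\<^sub>C chi x)
        \<le> (\<Sum>x\<in>F. norm ((coord (h r) x - coord g x) *\<^sub>C chi x))"
      by (rule norm_sum)
    also have "\<dots> = (\<Sum>x\<in>F. cmod (coord (h r) x - coord g x))"
      by (simp add: norm_scaleC norm_chi)
    also have "\<dots> < e / 2"
      by (rule elim)
    finally have "norm (\<Sum>x\<in>F. (coord (h r) x - coord g x) *\<^sub>C chi x) < e / 2" .
    moreover have "norm (proj (- F) (h r)) \<le> norm (proj (- F) g)"
      by (rule norm_le_norm_ell2) (simp add: coord_proj elim)
    moreover have "norm (h r - g) \<le> norm (\<Sum>x\<in>F. (coord (h r) x - coord g x) *\<^sub>C chi x)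
        + (norm (proj (- F) (h r)) + norm (proj (- F) g))"
      unfolding eq by (intro order_trans[OF norm_triangle_ineq] add_left_mono norm_triangle_ineq4)
    ultimately show ?case
      using g by (simp add: dist_norm)
  qed
qed

section \<open>Bounded operators\<close>

lemma mem_bounded_operators_iff:
  fixes T :: "'a oper"
  shows "T \<in> bounded_operators X \<longleftrightarrow> (\<forall>c f. T (c *\<^sub>C f) = c *\<^sub>C T f) \<and>
    (\<forall>f. proj X (T f) = T f) \<and> (\<forall>f. T (proj X f) = T f)"
proof -
  have "U = V \<longleftrightarrow> (\<forall>f. blinfun_apply U f = blinfun_apply V f)" for U V :: "'a oper"
    by (metis blinfun_eqI)
  then show ?thesis
    by (simp add: bounded_operators_def)
qed

lemma bounded_operators_scaleC:
  fixes T :: "'a oper"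
  shows "T \<in> bounded_operators X \<Longrightarrow> T (c *\<^sub>C f) = c *\<^sub>C T f"
  by (simp add: mem_bounded_operators_iff)

lemma bounded_operators_proj:
  fixes T :: "'a oper"
  shows "T \<in> bounded_operators X \<Longrightarrow> T (proj X f) = T f"
  by (simp add: mem_bounded_operators_iff)

lemma operator_algebra_bounded_operators: "operator_algebra (bounded_operators X)"
proof -
  have proj_scaleC: "proj X (c *\<^sub>C f) = c *\<^sub>C proj X f" for c f
    by (rule ell2_eqI) (simp add: coord_proj)
  show ?thesis
    unfolding operator_algebra_def
    by (auto simp: mem_bounded_operators_iff blinfun.add_left blinfun.add_right ell2.scale_right_distrib proj_scaleC
        mult.commute)
qed

lemma closed_bounded_operators: "closed (bounded_operators X)"
proof -
  have "continuous_on UNIV (\<lambda>T :: 'a oper. c *\<^sub>C T f)" for c f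
    by (rule bounded_linear.continuous_on[OF bounded_linear_scaleC]) (intro continuous_intros)
  then show ?thesis
    unfolding bounded_operators_def
    by (intro closed_Collect_conj closed_Collect_all closed_Collect_eq continuous_intros
        bounded_bilinear.continuous_on[OF bounded_bilinear_blinfun_compose])
qed

lemma proj_mem_bounded_operators: "proj X \<in> bounded_operators X"
  unfolding bounded_operators_def
  by (auto intro!: blinfun_eqI ell2_eqI simp: coord_proj)

text \<open>Empty sums need the zero operator, which \<open>operator_algebra\<close> does not list;
  a nonempty algebra contains it as a zero multiple.\<close>

lemma operator_algebra_sum:
  assumes "operator_algebra M" "M \<noteq> {}" "\<And>i. i \<in> I \<Longrightarrow> T i \<in> M"
  shows "(\<Sum>i\<in>I. T i) \<in> M"
proof -
  obtain U where "U \<in> M"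
    using assms(2) by blast
  then have "0 *\<^sub>O U \<in> M"
    using assms(1) by (simp add: operator_algebra_def)
  also have "0 *\<^sub>O U = 0"
    by (intro blinfun_eqI ell2_eqI) simp
  finally have "0 \<in> M" .
  with assms show ?thesis
    by (induction I rule: infinite_finite_induct) (auto simp: operator_algebra_def)
qed

section \<open>Norm bounds and Schur multipliers\<close>

text \<open>\<open>T\<close> sees only \<open>proj X f\<close>, which is a limit of such finite
  sums; both sides of the bound are continuous.\<close>

lemma norm_le_on_sum_chi:
  fixes T :: "'a oper"
  assumes T: "T \<in> bounded_operators X" and "B \<ge> 0"
    and bound: "\<And>F w. finite F \<Longrightarrow> F \<subseteq> X \<Longrightarrow>
      norm (T (\<Sum>x\<in>F. w x *\<^sub>C chi x)) \<le> B * norm (\<Sum>x\<in>F. w x *\<^sub>C chi x)"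
  shows "norm T \<le> B"
proof (rule norm_blinfun_bound[OF \<open>B \<ge> 0\<close>])
  fix f :: "'a ell2"
  let ?s = "\<lambda>F. \<Sum>x\<in>F. coord f x *\<^sub>C chi x"
  have s: "(?s \<longlongrightarrow> proj X f) (finite_subsets_at_top X)"
    using chi_expansion[of f X] by (simp add: has_sum_def)
  have "norm (T (proj X f)) \<le> B * norm (proj X f)"
  proof (rule tendsto_le[OF finite_subsets_at_top_neq_bot])
    show "((\<lambda>F. B * norm (?s F)) \<longlongrightarrow> B * norm (proj X f)) (finite_subsets_at_top X)"
      by (intro tendsto_intros s)
    show "((\<lambda>F. norm (T (?s F))) \<longlongrightarrow> norm (T (proj X f))) (finite_subsets_at_top X)"
      by (intro tendsto_intros s)
    show "\<forall>\<^sub>F F in finite_subsets_at_top X. norm (T (?s F)) \<le> B * norm (?s F)"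
      by (rule eventually_finite_subsets_at_top_weakI) (rule bound)
  qed
  also have "\<dots> \<le> B * norm f"
    using \<open>B \<ge> 0\<close> by (intro mult_left_mono norm_proj_le)
  finally show "norm (T f) \<le> B * norm f"
    by (simp add: bounded_operators_proj[OF T])
qed

text \<open>
  A Schur multiplier of the form \<open>\<Sum>\<^sub>m a\<^sub>m(x) b\<^sub>m(y)\<close> turns \<open>A\<close> into \<open>\<Sum>\<^sub>m D(a\<^sub>m) A D(b\<^sub>m)\<close> with
  diagonal operators \<open>D\<close>, which is a row contraction times a column contraction. The sum over \<open>m\<close>
  is finite on each basis vector \<open>chi y\<close>, with \<open>d y\<close> bounding the indices involved.
\<close>

lemma schur_multiplier_contractive:
  fixes T A :: "'a oper" and a b :: "nat \<Rightarrow> 'a \<Rightarrow> real" and d :: "'a \<Rightarrow> nat"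
  assumes T: "T \<in> bounded_operators X" and A: "A \<in> bounded_operators X"
    and a: "\<And>x N. (\<Sum>m\<le>N. (a m x)\<^sup>2) \<le> 1" and b: "\<And>y N. (\<Sum>m\<le>N. (b m y)\<^sup>2) \<le> 1"
    and symbol: "\<And>x y N. y \<in> X \<Longrightarrow> d y \<le> N \<Longrightarrow>
      coord (T (chi y)) x = of_real (\<Sum>m\<le>N. a m x * b m y) * coord (A (chi y)) x"
  shows "norm T \<le> norm A"
proof (rule norm_le_on_sum_chi[OF T norm_ge_zero])
  fix F and w :: "'a \<Rightarrow> complex"
  assume F: "finite F" "F \<subseteq> X"
  define f where "f = (\<Sum>y\<in>F. w y *\<^sub>C chi y)"
  \<comment> \<open>One cutoff for all basis vectors in \<open>F\<close>; a sum, unlike a maximum,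
    also covers empty \<open>F\<close>.\<close>
  define N where "N = (\<Sum>y\<in>F. d y)"
  have N: "d y \<le> N" if "y \<in> F" for y
    unfolding N_def using that F(1) by (intro member_le_sum) auto
  \<comment> \<open>The diagonal operator with entries \<open>b m\<close> applied to
    \<open>f\<close>.\<close>
  define g where "g m = (\<Sum>y\<in>F. (of_real (b m y) * w y) *\<^sub>C chi y)" for m
  have apply_sum: "U (\<Sum>y\<in>F. v y *\<^sub>C chi y) = (\<Sum>y\<in>F. v y *\<^sub>C U (chi y))"
    if "U \<in> bounded_operators X" for U v
    by (simp add: blinfun.sum_right bounded_operators_scaleC[OF that])
  have coord_Tf: "coord (T f) x = (\<Sum>m\<le>N. of_real (a m x) * coord (A (g m)) x)" for x
  proof -
    have "coord (T f) x = (\<Sum>y\<in>F. w y * coord (T (chi y)) x)"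
      by (simp add: f_def apply_sum[OF T])
    also have "\<dots> = (\<Sum>y\<in>F. \<Sum>m\<le>N. of_real (a m x) * ((of_real (b m y) * w y) * coord (A (chi y)) x))"
    proof (rule sum.cong[OF refl])
      fix y assume "y \<in> F"
      then have "coord (T (chi y)) x = of_real (\<Sum>m\<le>N. a m x * b m y) * coord (A (chi y)) x"
        using F N by (intro symbol) auto
      then show "w y * coord (T (chi y)) x
          = (\<Sum>m\<le>N. of_real (a m x) * ((of_real (b m y) * w y) * coord (A (chi y)) x))"
        by (simp add: sum_distrib_left sum_distrib_right mult_ac)
    qed
    also have "\<dots> = (\<Sum>m\<le>N. of_real (a m x) * (\<Sum>y\<in>F. (of_real (b m y) * w y) * coord (A (chi y)) x))"
      by (subst sum.swap) (simp add: sum_distrib_left)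
    also have "\<dots> = (\<Sum>m\<le>N. of_real (a m x) * coord (A (g m)) x)"
      by (simp add: g_def apply_sum[OF A])
    finally show ?thesis .
  qed
  \<comment> \<open>Cauchy-Schwarz in \<open>m\<close>; the bound on \<open>a\<close> is the row
    contraction.\<close>
  have row: "(cmod (coord (T f) x))\<^sup>2 \<le> (\<Sum>m\<le>N. (cmod (coord (A (g m)) x))\<^sup>2)" for x
  proof -
    have "cmod (coord (T f) x) \<le> (\<Sum>m\<le>N. \<bar>a m x\<bar> * \<bar>cmod (coord (A (g m)) x)\<bar>)"
      unfolding coord_Tf by (rule sum_norm_le) (simp add: norm_mult)
    also have "\<dots> \<le> L2_set (\<lambda>m. a m x) {..N} * L2_set (\<lambda>m. cmod (coord (A (g m)) x)) {..N}"
      by (rule L2_set_mult_ineq)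
    also have "\<dots> \<le> 1 * L2_set (\<lambda>m. cmod (coord (A (g m)) x)) {..N}"
      by (intro mult_right_mono) (simp_all add: L2_set_def a sum_nonneg)
    finally have "(cmod (coord (T f) x))\<^sup>2 \<le> (L2_set (\<lambda>m. cmod (coord (A (g m)) x)) {..N})\<^sup>2"
      by (intro power_mono) auto
    then show ?thesis
      by (simp add: L2_set_power2)
  qed
  \<comment> \<open>By orthogonality of the basis vectors, the bound on \<open>b\<close> is the
    column contraction.\<close>
  have column: "(\<Sum>m\<le>N. (norm (g m))\<^sup>2) \<le> (norm f)\<^sup>2"
  proof -
    have "(\<Sum>m\<le>N. (norm (g m))\<^sup>2) = (\<Sum>y\<in>F. (\<Sum>m\<le>N. (b m y)\<^sup>2) * (cmod (w y))\<^sup>2)"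
      unfolding g_def norm_sum_chi[OF F(1)]
      by (subst sum.swap) (simp add: norm_mult power_mult_distrib sum_distrib_right)
    also have "\<dots> \<le> (\<Sum>y\<in>F. 1 * (cmod (w y))\<^sup>2)"
      by (intro sum_mono mult_right_mono b) auto
    finally show ?thesis
      by (simp add: f_def norm_sum_chi[OF F(1)])
  qed
  have "norm (T f) \<le> norm A * norm f"
  proof (rule norm_ell2_leI)
    fix G :: "'a set" assume G: "finite G"
    have "(L2_set (\<lambda>x. cmod (coord (T f) x)) G)\<^sup>2 = (\<Sum>x\<in>G. (cmod (coord (T f) x))\<^sup>2)"
      by (rule L2_set_power2)
    also have "\<dots> \<le> (\<Sum>x\<in>G. \<Sum>m\<le>N. (cmod (coord (A (g m)) x))\<^sup>2)"
      by (intro sum_mono row)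
    also have "\<dots> = (\<Sum>m\<le>N. (L2_set (\<lambda>x. cmod (coord (A (g m)) x)) G)\<^sup>2)"
      by (subst sum.swap) (simp add: L2_set_power2)
    also have "\<dots> \<le> (\<Sum>m\<le>N. (norm A * norm (g m))\<^sup>2)"
      using G by (intro sum_mono power_mono order_trans[OF L2_set_le_norm_ell2 norm_blinfun]) auto
    also have "\<dots> = (norm A)\<^sup>2 * (\<Sum>m\<le>N. (norm (g m))\<^sup>2)"
      by (simp add: power_mult_distrib sum_distrib_left)
    also have "\<dots> \<le> (norm A)\<^sup>2 * (norm f)\<^sup>2"
      by (intro mult_left_mono column) auto
    also have "\<dots> = (norm A * norm f)\<^sup>2"
      by (simp only: power_mult_distrib)
    finally show "L2_set (\<lambda>x. cmod (coord (T f) x)) G \<le> norm A * norm f"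
      by (rule power2_le_imp_le) simp
  qed
  then show "norm (T (\<Sum>y\<in>F. w y *\<^sub>C chi y)) \<le> norm A * norm (\<Sum>y\<in>F. w y *\<^sub>C chi y)"
    by (simp add: f_def)
qed

section \<open>Strong operator convergence\<close>

text \<open>The topology is pulled back from the product topology on functions, where convergence is
  pointwise.\<close>

lemma limitin_strong_operator_topology:
  "limitin strong_operator_topology T A G \<longleftrightarrow> (\<forall>f. ((\<lambda>r. blinfun_apply (T r) f) \<longlongrightarrow> A f) G)"
proof
  assume lim: "limitin strong_operator_topology T A G"
  show "\<forall>f. ((\<lambda>r. blinfun_apply (T r) f) \<longlongrightarrow> A f) G"
  proof
    fix f
    show "((\<lambda>r. blinfun_apply (T r) f) \<longlongrightarrow> A f) G"
      using continuous_map_limit[OF strong_operator_topology_continuous_evaluation lim, of f]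
      by (simp add: o_def)
  qed
next
  assume lim: "\<forall>f. ((\<lambda>r. blinfun_apply (T r) f) \<longlongrightarrow> A f) G"
  show "limitin strong_operator_topology T A G"
    unfolding limitin_def
  proof (intro conjI allI impI)
    show "A \<in> topspace strong_operator_topology"
      by (simp add: strong_operator_topology_topspace)
    fix U assume U: "openin strong_operator_topology U \<and> A \<in> U"
    then obtain V where V: "open V" "U = blinfun_apply -` V"
      unfolding strong_operator_topology_def openin_pullback_topology by auto
    have "limitin euclidean (\<lambda>r. blinfun_apply (T r)) (blinfun_apply A) G"
      using lim by (simp add: limitin_componentwise flip: euclidean_product_topology
          del: limitin_canonical_iff) simp
    then show "\<forall>\<^sub>F r in G. T r \<in> U"
      using U V by (auto simp: limitin_def)
  qed
qed

text \<open>The uniform norm bound transfers convergence from finite combinations of basis vectors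
  to every \<open>f\<close>, by approximating \<open>proj X f\<close>.\<close>

lemma strong_limit_on_chi:
  fixes T :: "'b \<Rightarrow> 'a oper"
  assumes T: "\<And>r. r \<in> R \<Longrightarrow> T r \<in> bounded_operators X" and A: "A \<in> bounded_operators X"
    and bound: "\<And>r. r \<in> R \<Longrightarrow> norm (T r) \<le> norm A" and R: "\<forall>\<^sub>F r in G. r \<in> R"
    and lim: "\<And>x. x \<in> X \<Longrightarrow> ((\<lambda>r. blinfun_apply (T r) (chi x)) \<longlongrightarrow> A (chi x)) G"
  shows "((\<lambda>r. blinfun_apply (T r) f) \<longlongrightarrow> A f) G"
proof (rule tendstoI)
  fix e :: real assume "e > 0"
  \<comment> \<open>The \<open>+ 1\<close> keeps the denominator positive when \<open>A\<close> is
    zero.\<close>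
  define \<delta> where "\<delta> = e / (4 * (norm A + 1))"
  have \<delta>: "\<delta> > 0" "norm A * \<delta> \<le> e / 4"
    using \<open>e > 0\<close> by (auto simp: \<delta>_def field_simps add_pos_nonneg)
  obtain F where F: "finite F" "F \<subseteq> X" "norm (proj X f - (\<Sum>x\<in>F. coord f x *\<^sub>C chi x)) < \<delta>"
    using sum_chi_approximation[OF \<delta>(1)] by blast
  define p where "p = (\<Sum>x\<in>F. coord f x *\<^sub>C chi x)"
  have near: "norm (U f - U p) \<le> e / 4" if "U \<in> bounded_operators X" "norm U \<le> norm A" for U
  proof -
    have "norm (U f - U p) = norm (U (proj X f - p))"
      by (simp add: blinfun.diff_right bounded_operators_proj[OF that(1)])
    also have "\<dots> \<le> norm U * norm (proj X f - p)"
      by (rule norm_blinfun)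
    also have "\<dots> \<le> norm A * \<delta>"
      using that(2) F(3) by (intro mult_mono) (auto simp: p_def)
    also have "\<dots> \<le> e / 4"
      by (rule \<delta>)
    finally show ?thesis .
  qed
  have apply_p: "U p = (\<Sum>x\<in>F. coord f x *\<^sub>C U (chi x))" if "U \<in> bounded_operators X" for U
    by (simp add: p_def blinfun.sum_right bounded_operators_scaleC[OF that])
  have "((\<lambda>r. \<Sum>x\<in>F. coord f x *\<^sub>C blinfun_apply (T r) (chi x)) \<longlongrightarrow> (\<Sum>x\<in>F. coord f x *\<^sub>C A (chi x))) G"
    using F(2) by (intro tendsto_sum bounded_linear.tendsto[OF bounded_linear_scaleC] lim) auto
  then have "\<forall>\<^sub>F r in G. dist (\<Sum>x\<in>F. coord f x *\<^sub>C blinfun_apply (T r) (chi x)) (A p) < e / 2"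
    unfolding apply_p[OF A] using \<open>e > 0\<close> by (intro tendstoD) auto
  with R show "\<forall>\<^sub>F r in G. dist (blinfun_apply (T r) f) (A f) < e"
  proof eventually_elim
    case (elim r)
    have "norm (T r f - T r p) \<le> e / 4" "norm (A f - A p) \<le> e / 4"
      using T[OF elim(1)] bound[OF elim(1)] A by (simp_all only: near order_refl)
    moreover have "norm (T r p - A p) < e / 2"
      using elim(2) by (simp add: apply_p[OF T[OF elim(1)]] dist_norm)
    moreover have "norm (T r f - A f) \<le> norm (T r f - T r p) + norm (T r p - A p) + norm (A f - A p)"
      by norm
    ultimately show ?case
      unfolding dist_norm by linarith
  qed
qed

text \<open>The norm is lower semicontinuous under strong limits: a vector witnessing
  \<open>B < norm A\<close> eventually witnesses \<open>B < norm (T r)\<close>. The assumed bound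
  gives the other half.\<close>

lemma norm_tendsto_of_strong_limit:
  fixes T :: "'b \<Rightarrow> 'a::real_normed_vector \<Rightarrow>\<^sub>L 'c::real_normed_vector" and A :: "'a \<Rightarrow>\<^sub>L 'c"
  assumes bound: "\<forall>\<^sub>F r in G. norm (T r) \<le> norm A"
    and lim: "\<And>f. ((\<lambda>r. blinfun_apply (T r) f) \<longlongrightarrow> A f) G"
  shows "((\<lambda>r. norm (T r)) \<longlongrightarrow> norm A) G"
proof (rule order_tendstoI)
  fix B assume "B < norm A"
  show "\<forall>\<^sub>F r in G. B < norm (T r)"
  proof (cases "B < 0")
    case True
    then show ?thesis
      by (intro always_eventually allI) (rule less_le_trans[OF _ norm_ge_zero])
  next
    case False
    obtain f where f: "B * norm f < norm (A f)"
      using norm_blinfun_bound[of B A] \<open>B < norm A\<close> False by (meson not_le)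
    have "\<forall>\<^sub>F r in G. B * norm f < norm (blinfun_apply (T r) f)"
      by (rule order_tendstoD(1)[OF tendsto_norm[OF lim] f])
    then show ?thesis
    proof eventually_elim
      case (elim r)
      then have "B * norm f < norm (T r) * norm f"
        using norm_blinfun[of "T r" f] by simp
      then show ?case
        using mult_right_less_imp_less by fastforce
    qed
  qed
next
  fix B assume "norm A < B"
  with bound show "\<forall>\<^sub>F r in G. norm (T r) < B"
    by (auto elim: eventually_mono)
qed

section \<open>A factorization of the Poisson kernel\<close>

text \<open>
  The rows of the Cholesky factor of the matrix \<open>r\<^bsup>\<bar>a - b\<bar>\<^esup>\<close>: unit vectors generated by
  \<open>v\<^sub>0 = e\<^sub>0\<close> and \<open>v\<^sub>a\<^sub>+\<^sub>1 = r v\<^sub>a + \<surd>(1 - r\<^sup>2) e\<^sub>a\<^sub>+\<^sub>1\<close>.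
\<close>

definition poisson_factor :: "real \<Rightarrow> nat \<Rightarrow> nat \<Rightarrow> real"
  where "poisson_factor r m a =
    (if m \<le> a then r ^ (a - m) * (if m = 0 then 1 else sqrt (1 - r\<^sup>2)) else 0)"

text \<open>On the indices \<open>m \<le> b\<close> the row of \<open>a\<close> is
  \<open>r ^ (a - b)\<close> times the row of \<open>b\<close>, apart from the index-independent
  weights, and the row of \<open>b\<close> is a unit vector supported there. Hence any cutoff
  \<open>N \<ge> b\<close> suffices.\<close>

lemma poisson_factor_inner:
  assumes r: "0 \<le> r" "r < 1" and "b \<le> a" "b \<le> N"
  shows "(\<Sum>m\<le>N. poisson_factor r m a * poisson_factor r m b) = r ^ (a - b)"
proof -
  let ?w = "\<lambda>m :: nat. if m = 0 then 1 else 1 - r\<^sup>2"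
  \<comment> \<open>Passing from \<open>b\<close> to \<open>Suc b\<close> scales the old terms by
    the square of \<open>r\<close> and adds the complementary weight.\<close>
  have unit: "(\<Sum>m\<le>b. (r ^ (b - m))\<^sup>2 * ?w m) = 1" for b
  proof (induction b)
    case (Suc b)
    have "(\<Sum>m\<le>b. (r ^ (Suc b - m))\<^sup>2 * ?w m) = r\<^sup>2 * (\<Sum>m\<le>b. (r ^ (b - m))\<^sup>2 * ?w m)"
      unfolding sum_distrib_left
      by (rule sum.cong) (auto simp: Suc_diff_le power_mult_distrib)
    then show ?case
      using Suc by simp
  qed simp
  have r2: "r\<^sup>2 \<le> 1"
    using r by (simp add: power_le_one)
  have "(\<Sum>m\<le>N. poisson_factor r m a * poisson_factor r m b)
      = (\<Sum>m\<le>b. poisson_factor r m a * poisson_factor r m b)"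
    using \<open>b \<le> N\<close> by (intro sum.mono_neutral_right) (auto simp: poisson_factor_def)
  also have "\<dots> = (\<Sum>m\<le>b. r ^ (a - b) * ((r ^ (b - m))\<^sup>2 * ?w m))"
  proof (rule sum.cong[OF refl])
    fix m assume "m \<in> {..b}"
    then have "r ^ (a - m) = r ^ (a - b) * r ^ (b - m)"
      using \<open>b \<le> a\<close> by (simp flip: power_add)
    then show "poisson_factor r m a * poisson_factor r m b = r ^ (a - b) * ((r ^ (b - m))\<^sup>2 * ?w m)"
      using \<open>m \<in> {..b}\<close> \<open>b \<le> a\<close> r2 by (simp add: poisson_factor_def power2_eq_square)
  qed
  also have "\<dots> = r ^ (a - b)"
    by (simp only: unit mult_1_right flip: sum_distrib_left)
  finally show ?thesis .
qed

lemma poisson_factor_sq_sum_le: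
  assumes "0 \<le> r" "r < 1"
  shows "(\<Sum>m\<le>N. (poisson_factor r m a)\<^sup>2) \<le> 1"
proof -
  \<comment> \<open>Enlarging the range to reach \<open>a\<close> completes the unit vector.\<close>
  have "(\<Sum>m\<le>N. (poisson_factor r m a)\<^sup>2) \<le> (\<Sum>m\<le>max N a. (poisson_factor r m a)\<^sup>2)"
    by (intro sum_mono2) auto
  also have "\<dots> = 1"
    using poisson_factor_inner[OF assms, of a a "max N a"] by (simp add: power2_eq_square)
  finally show ?thesis .
qed

section \<open>The universal model\<close>

locale universal_model =
  fixes k :: nat and n :: "nat \<Rightarrow> nat" and lam :: coeff_family
  assumes unimodular: "\<And>i j s t. \<lbrakk>i \<in> {1..k}; j \<in> {1..k}; i \<noteq> j; s \<in> {1..n i}; t \<in> {1..n j}\<rbrakk>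
      \<Longrightarrow> cmod (lam i j s t) = 1"
begin

section \<open>The closed algebra generated by the shifts\<close>

lemma poly_algebra_closed: "closed (poly_algebra k n lam)"
  and operator_algebra_poly_algebra: "operator_algebra (poly_algebra k n lam)"
proof -
  have "closed (poly_algebra k n lam) \<and> operator_algebra (poly_algebra k n lam)"
    unfolding poly_algebra_def by (rule hull_in) (auto simp: operator_algebra_def)
  then show "closed (poly_algebra k n lam)" "operator_algebra (poly_algebra k n lam)"
    by auto
qed

lemma proj_mem_poly_algebra: "proj (words k n) \<in> poly_algebra k n lam"
  unfolding poly_algebra_def by (rule hull_inc) simp

lemma shift_mem_poly_algebra:
  "i \<in> {1..k} \<Longrightarrow> s \<in> {1..n i} \<Longrightarrow> shift k n lam i s \<in> poly_algebra k n lam"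
  unfolding poly_algebra_def by (rule hull_inc) blast

text \<open>The bounded operators on the model space themselves form a closed algebra containing the
  generators, so minimality of the hull applies.\<close>

lemma poly_algebra_subset: "poly_algebra k n lam \<subseteq> bounded_operators (words k n)"
  unfolding poly_algebra_def
  using closed_bounded_operators operator_algebra_bounded_operators proj_mem_bounded_operators
    shift_props(1)[of k n lam, OF unimodular]
  by (intro hull_minimal) auto

lemma shift_word_mem_poly_algebra:
  assumes "i \<in> {1..k}" "w \<in> lists {1..n i}"
  shows "shift_word k n lam i w \<in> poly_algebra k n lam"
  using assms(2)
proof (induction w)
  case Nil
  show ?case
    by (simp add: shift_word_def proj_mem_poly_algebra)
next
  case (Cons s w)
  then show ?case
    using operator_algebra_poly_algebra shift_mem_poly_algebra[OF assms(1), of s]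
    by (simp add: shift_word_def operator_algebra_def)
qed

lemma shift_tuple_mem_poly_algebra:
  assumes "\<beta> \<in> words k n"
  shows "shift_tuple k n lam \<beta> \<in> poly_algebra k n lam"
proof -
  have "foldr (\<lambda>i T. shift_word k n lam i (\<beta> i) o\<^sub>L T) js (proj (words k n)) \<in> poly_algebra k n lam"
    if "set js \<subseteq> {1..k}" for js
    using that
  proof (induction js)
    case (Cons i js)
    then have "shift_word k n lam i (\<beta> i) \<in> poly_algebra k n lam"
      using words_mem[OF assms] by (intro shift_word_mem_poly_algebra) auto
    then show ?case
      using Cons operator_algebra_poly_algebra by (simp add: operator_algebra_def)
  qed (simp add: proj_mem_poly_algebra)
  then show ?thesis
    unfolding shift_tuple_def by (simp add: atLeastLessThanSuc_atLeastAtMost del: upt_Suc)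
qed

lemma homogeneous_part_mem_poly_algebra:
  "homogeneous_part k n lam c r p \<in> poly_algebra k n lam"
  unfolding homogeneous_part_def
  using operator_algebra_poly_algebra proj_mem_poly_algebra shift_tuple_mem_poly_algebra
  by (intro operator_algebra_sum) (auto simp: operator_algebra_def)

text \<open>Isolates the geometric factor, so that a bound uniform in \<open>p\<close> at
  \<open>r = 1\<close> yields summability for \<open>r < 1\<close>.\<close>

lemma homogeneous_part_eq_scaleR:
  "homogeneous_part k n lam c r p = r ^ p *\<^sub>R homogeneous_part k n lam c 1 p"
  by (intro blinfun_eqI ell2_eqI)
    (simp add: homogeneous_part_def blinfun.sum_left blinfun.scaleR_left sum_distrib_left mult_ac)

lemma dilated_series_mem_poly_algebra:
  assumes "summable (homogeneous_part k n lam c r)"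
  shows "dilated_series k n lam c r \<in> poly_algebra k n lam"
proof (rule closed_sequentially[OF poly_algebra_closed])
  show "(\<lambda>N. \<Sum>p<N. homogeneous_part k n lam c r p) \<longlonglongrightarrow> dilated_series k n lam c r"
    unfolding dilated_series_def using assms by (rule summable_LIMSEQ)
  show "(\<Sum>p<N. homogeneous_part k n lam c r p) \<in> poly_algebra k n lam" for N
    using operator_algebra_poly_algebra proj_mem_poly_algebra homogeneous_part_mem_poly_algebra
    by (intro operator_algebra_sum) auto
qed

text \<open>Up to a unimodular factor the image of \<open>chi \<gamma>\<close> is a basis vector,
  whose degree is the sum of the two word lengths.\<close>

lemma coord_shift_tuple_chi_eq_0:
  assumes "\<beta> \<in> words k n" "\<gamma> \<in> words k n" "wlen k \<alpha> \<noteq> wlen k \<beta> + wlen k \<gamma>"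
  shows "coord (shift_tuple k n lam \<beta> (chi \<gamma>)) \<alpha> = 0"
proof -
  let ?\<beta>\<gamma> = "\<lambda>i. if i \<in> {1..k} then \<beta> i @ \<gamma> i else \<gamma> i"
  obtain u where u: "shift_tuple k n lam \<beta> (chi \<gamma>) = u *\<^sub>C chi ?\<beta>\<gamma>"
    using shift_tuple_chi[of k n lam, OF unimodular assms(1,2)] by blast
  have "wlen k ?\<beta>\<gamma> = wlen k \<beta> + wlen k \<gamma>"
    by (simp add: wlen_def sum.distrib)
  then have "\<alpha> \<noteq> ?\<beta>\<gamma>"
    using assms(3) by blast
  then show ?thesis
    unfolding u by (simp only: coord_simps coord_chi if_False mult_zero_right)
qed

end

section \<open>Operators with a Fourier representation\<close>

lemma eventually_at_left_1: "\<forall>\<^sub>F r in at_left 1. r \<in> {0..<1 :: real}"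
  using eventually_at_left_real[of 0 "1 :: real"] by (auto elim: eventually_mono)

locale hardy_operator = universal_model +
  fixes c :: "word_tuple \<Rightarrow> complex" and A :: "word_tuple oper"
  assumes rep: "fourier_rep k n lam c A"
begin

lemma A_bounded_operator: "A \<in> bounded_operators (words k n)"
  using rep by (simp add: fourier_rep_def)

section \<open>Matrix entries of the operator and its homogeneous parts\<close>

text \<open>A basis vector is a polynomial on which \<open>series_poly\<close> is the single term
  \<open>series_chi\<close>; a bounded coordinate functional passes through that sum.\<close>

lemma coord_A_chi_has_sum:
  assumes \<gamma>: "\<gamma> \<in> words k n"
  shows "((\<lambda>\<beta>. c \<beta> * coord (shift_tuple k n lam \<beta> (chi \<gamma>)) \<alpha>) has_sum coord (A (chi \<gamma>)) \<alpha>) (words k n)"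
proof -
  have "chi \<gamma> \<in> polys k n"
    unfolding polys_def using \<gamma> by (intro ell2.span_base) simp
  then have "A (chi \<gamma>) = series_poly k n lam c (chi \<gamma>)"
    using rep by (simp add: fourier_rep_def)
  also have "\<dots> = series_chi k n lam c \<gamma>"
    by (simp add: series_poly_def coord_chi)
  finally have "((\<lambda>\<beta>. c \<beta> *\<^sub>C shift_tuple k n lam \<beta> (chi \<gamma>)) has_sum A (chi \<gamma>)) (words k n)"
    unfolding series_chi_def
    using series_chi_summable[of k n lam, OF unimodular _ \<gamma>] rep by (simp add: fourier_rep_def)
  from has_sum_bounded_linear[OF bounded_linear_coord this, of \<alpha>] show ?thesis
    by (simp add: o_def)
qed

text \<open>Lower triangularity for the grading: no shift monomial lowers the degree.\<close>

lemma coord_A_chi_eq_0: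
  assumes "\<gamma> \<in> words k n" "wlen k \<alpha> < wlen k \<gamma>"
  shows "coord (A (chi \<gamma>)) \<alpha> = 0"
proof -
  have "((\<lambda>\<beta>. c \<beta> * coord (shift_tuple k n lam \<beta> (chi \<gamma>)) \<alpha>) has_sum 0) (words k n)"
    using assms by (intro has_sum_0) (simp add: coord_shift_tuple_chi_eq_0)
  then show ?thesis
    using coord_A_chi_has_sum[OF assms(1)] has_sum_unique by blast
qed

text \<open>Only words of length \<open>wlen k \<alpha> - wlen k \<gamma>\<close> contribute to an
  entry, so each entry of \<open>A\<close> comes from a single homogeneous part and its sum is
  finite.\<close>

lemma coord_homogeneous_part_chi:
  assumes \<gamma>: "\<gamma> \<in> words k n"
  shows "coord (homogeneous_part k n lam c r p (chi \<gamma>)) \<alpha> =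
    (if wlen k \<alpha> = p + wlen k \<gamma> then of_real (r ^ p) * coord (A (chi \<gamma>)) \<alpha> else 0)"
proof -
  let ?f = "\<lambda>\<beta>. c \<beta> * coord (shift_tuple k n lam \<beta> (chi \<gamma>)) \<alpha>"
  let ?W = "{\<beta>. \<beta> \<in> words k n \<and> wlen k \<beta> = p}"
  have hom: "coord (homogeneous_part k n lam c r p (chi \<gamma>)) \<alpha> = of_real (r ^ p) * sum ?f ?W"
    by (simp add: homogeneous_part_def blinfun.sum_left sum_distrib_left mult_ac)
  show ?thesis
  proof (cases "wlen k \<alpha> = p + wlen k \<gamma>")
    case True
    have "(?f has_sum coord (A (chi \<gamma>)) \<alpha>) (words k n) \<longleftrightarrow> (?f has_sum coord (A (chi \<gamma>)) \<alpha>) ?W"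
      using True \<gamma> by (intro has_sum_cong_neutral) (auto intro!: coord_shift_tuple_chi_eq_0)
    then have "(?f has_sum coord (A (chi \<gamma>)) \<alpha>) ?W"
      using coord_A_chi_has_sum[OF \<gamma>] by simp
    then have "sum ?f ?W = coord (A (chi \<gamma>)) \<alpha>"
      using has_sum_unique[OF has_sum_finite[OF finite_words_of_length]] by blast
    then show ?thesis
      using True by (simp add: hom)
  next
    case False
    then have "sum ?f ?W = 0"
      using \<gamma> by (intro sum.neutral) (auto intro!: coord_shift_tuple_chi_eq_0)
    then show ?thesis
      using False by (simp add: hom)
  qed
qed

section \<open>Norm convergence and entries of the dilated series\<close>

text \<open>The part of degree \<open>p\<close> keeps the blocks of \<open>A\<close> on the
  \<open>p\<close>-th subdiagonal. Indicators of degrees factor this symbol, and each degree meets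
  at most one \<open>m\<close>.\<close>

lemma norm_homogeneous_part_le: "norm (homogeneous_part k n lam c 1 p) \<le> norm A"
proof (rule schur_multiplier_contractive[where X = "words k n" and d = "wlen k"
      and a = "\<lambda>m \<alpha>. of_bool (wlen k \<alpha> = m + p)" and b = "\<lambda>m \<gamma>. of_bool (wlen k \<gamma> = m)"])
  show "homogeneous_part k n lam c 1 p \<in> bounded_operators (words k n)"
    using homogeneous_part_mem_poly_algebra poly_algebra_subset by blast
  show "A \<in> bounded_operators (words k n)"
    by (rule A_bounded_operator)
  have at_most_one: "(\<Sum>m\<le>N. (of_bool (m = l \<and> Q) :: real)\<^sup>2) \<le> 1" for l N :: nat and Q
  proof -
    have "(\<Sum>m\<le>N. (of_bool (m = l \<and> Q) :: real)\<^sup>2) = (\<Sum>m\<le>N. if m = l then of_bool Q else 0)"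
      by (intro sum.cong) auto
    then show ?thesis
      by (simp add: sum.delta)
  qed
  \<comment> \<open>Natural subtraction truncates, so \<open>p \<le> wlen k \<alpha>\<close> has to
    be recorded separately, as \<open>Q\<close>.\<close>
  have "(wlen k \<alpha> = m + p) = (m = wlen k \<alpha> - p \<and> p \<le> wlen k \<alpha>)" for m \<alpha>
    by auto
  then show "(\<Sum>m\<le>N. (of_bool (wlen k \<alpha> = m + p) :: real)\<^sup>2) \<le> 1" for \<alpha> N
    using at_most_one by presburger
  show "(\<Sum>m\<le>N. (of_bool (wlen k \<gamma> = m) :: real)\<^sup>2) \<le> 1" for \<gamma> N
    using at_most_one[of "wlen k \<gamma>" True N] by (simp add: eq_commute)
  fix \<alpha> \<gamma> and N :: nat
  assume \<gamma>: "\<gamma> \<in> words k n" and N: "wlen k \<gamma> \<le> N"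
  have "(\<Sum>m\<le>N. of_bool (wlen k \<alpha> = m + p) * of_bool (wlen k \<gamma> = m))
      = (\<Sum>m\<le>N. if wlen k \<gamma> = m then of_bool (wlen k \<alpha> = m + p) else (0 :: real))"
    by (intro sum.cong) auto
  also have "\<dots> = of_bool (wlen k \<alpha> = p + wlen k \<gamma>)"
    using N by (simp add: add.commute)
  finally show "coord (homogeneous_part k n lam c 1 p (chi \<gamma>)) \<alpha>
      = of_real (\<Sum>m\<le>N. of_bool (wlen k \<alpha> = m + p) * of_bool (wlen k \<gamma> = m)) * coord (A (chi \<gamma>)) \<alpha>"
    by (simp add: coord_homogeneous_part_chi[OF \<gamma>])
qed

lemma summable_homogeneous_part:
  assumes "0 \<le> r" "r < 1"
  shows "summable (homogeneous_part k n lam c r)"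
proof (rule summable_comparison_test')
  show "summable (\<lambda>p. r ^ p * norm A)"
    using assms by (intro summable_mult2 summable_geometric) simp
  show "norm (homogeneous_part k n lam c r p) \<le> r ^ p * norm A" if "0 \<le> p" for p
    unfolding homogeneous_part_eq_scaleR[of c r]
    using assms(1) by (simp add: mult_left_mono norm_homogeneous_part_le)
qed

lemma dilated_series_bounded_operator:
  assumes "0 \<le> r" "r < 1"
  shows "dilated_series k n lam c r \<in> bounded_operators (words k n)"
  using dilated_series_mem_poly_algebra[OF summable_homogeneous_part[OF assms]] poly_algebra_subset
  by blast

text \<open>One homogeneous part contributes to each entry. Where the exponent truncates to 0
  because \<open>wlen k \<alpha> < wlen k \<gamma>\<close>, the entry of \<open>A\<close>
  vanishes.\<close>

lemma coord_dilated_series_chi: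
  assumes r: "0 \<le> r" "r < 1" and \<gamma>: "\<gamma> \<in> words k n"
  shows "coord (dilated_series k n lam c r (chi \<gamma>)) \<alpha> =
    of_real (r ^ (wlen k \<alpha> - wlen k \<gamma>)) * coord (A (chi \<gamma>)) \<alpha>"
proof -
  have bl: "bounded_linear (\<lambda>T :: word_tuple oper. coord (T (chi \<gamma>)) \<alpha>)"
    by (rule bounded_linear_compose[OF bounded_linear_coord blinfun.bounded_linear_left])
  have sums: "(\<lambda>p. coord (homogeneous_part k n lam c r p (chi \<gamma>)) \<alpha>) sums
      coord (dilated_series k n lam c r (chi \<gamma>)) \<alpha>"
    unfolding dilated_series_def
    by (rule bounded_linear.sums[OF bl summable_sums[OF summable_homogeneous_part[OF r]]])
  show ?thesis
  proof (cases "wlen k \<gamma> \<le> wlen k \<alpha>")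
    case True
    then have "(\<lambda>p. coord (homogeneous_part k n lam c r p (chi \<gamma>)) \<alpha>) =
        (\<lambda>p. if p = wlen k \<alpha> - wlen k \<gamma> then of_real (r ^ p) * coord (A (chi \<gamma>)) \<alpha> else 0)"
      by (auto simp: coord_homogeneous_part_chi[OF \<gamma>])
    then show ?thesis
      using sums sums_single[of "wlen k \<alpha> - wlen k \<gamma>" "\<lambda>p. of_real (r ^ p) * coord (A (chi \<gamma>)) \<alpha>"]
      by (simp only: sums_unique2)
  next
    case False
    then have "(\<lambda>p. coord (homogeneous_part k n lam c r p (chi \<gamma>)) \<alpha>) = (\<lambda>p. 0)"
      by (auto simp: coord_homogeneous_part_chi[OF \<gamma>])
    then show ?thesis
      using sums sums_zero[where 'a = complex] sums_unique2 coord_A_chi_eq_0[OF \<gamma>, of \<alpha>] False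
      by (metis mult_zero_right not_le)
  qed
qed

section \<open>Contractivity and strong convergence of the dilated series\<close>

text \<open>On and below the diagonal the symbol is the inner product of two Poisson rows; above it
  both sides vanish by triangularity.\<close>

lemma norm_dilated_series_le:
  assumes r: "0 \<le> r" "r < 1"
  shows "norm (dilated_series k n lam c r) \<le> norm A"
proof (rule schur_multiplier_contractive[where X = "words k n" and d = "wlen k"
      and a = "\<lambda>m \<alpha>. poisson_factor r m (wlen k \<alpha>)" and b = "\<lambda>m \<gamma>. poisson_factor r m (wlen k \<gamma>)"])
  show "dilated_series k n lam c r \<in> bounded_operators (words k n)"
    using r by (rule dilated_series_bounded_operator)
  show "A \<in> bounded_operators (words k n)"
    by (rule A_bounded_operator)
  show "(\<Sum>m\<le>N. (poisson_factor r m (wlen k \<alpha>))\<^sup>2) \<le> 1" for \<alpha> N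
    using r by (rule poisson_factor_sq_sum_le)
  \<comment> \<open>The same family serves as \<open>a\<close> and as \<open>b\<close>, so the bound
    is due twice.\<close>
  then show "(\<Sum>m\<le>N. (poisson_factor r m (wlen k \<alpha>))\<^sup>2) \<le> 1" for \<alpha> N .
  fix \<alpha> \<gamma> and N :: nat
  assume \<gamma>: "\<gamma> \<in> words k n" and N: "wlen k \<gamma> \<le> N"
  show "coord (dilated_series k n lam c r (chi \<gamma>)) \<alpha> =
    of_real (\<Sum>m\<le>N. poisson_factor r m (wlen k \<alpha>) * poisson_factor r m (wlen k \<gamma>)) * coord (A (chi \<gamma>)) \<alpha>"
  proof (cases "wlen k \<gamma> \<le> wlen k \<alpha>")
    case True
    then show ?thesis
      using poisson_factor_inner[OF r True N] by (simp only: coord_dilated_series_chi[OF r \<gamma>])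
  next
    case False
    then show ?thesis
      by (simp add: coord_dilated_series_chi[OF r \<gamma>] coord_A_chi_eq_0[OF \<gamma>])
  qed
qed

text \<open>On \<open>chi \<gamma>\<close> each entry is that of \<open>A\<close> times a power of
  \<open>r\<close>: dominated by it and convergent to it. The contraction bound extends this to all
  vectors.\<close>

lemma dilated_series_strong_limit:
  "((\<lambda>r. blinfun_apply (dilated_series k n lam c r) f) \<longlongrightarrow> A f) (at_left 1)"
proof (rule strong_limit_on_chi[where R = "{0..<1}" and X = "words k n"])
  fix \<gamma> assume \<gamma>: "\<gamma> \<in> words k n"
  show "((\<lambda>r. blinfun_apply (dilated_series k n lam c r) (chi \<gamma>)) \<longlongrightarrow> A (chi \<gamma>)) (at_left 1)"
  proof (rule tendsto_ell2_dominated)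
    show "\<forall>\<^sub>F r in at_left 1. \<forall>\<alpha>. cmod (coord (dilated_series k n lam c r (chi \<gamma>)) \<alpha>)
        \<le> cmod (coord (A (chi \<gamma>)) \<alpha>)"
      using eventually_at_left_1
    proof eventually_elim
      case (elim r)
      then show ?case
        by (auto simp: coord_dilated_series_chi[OF _ _ \<gamma>] norm_mult norm_power
            intro!: mult_left_le_one_le power_le_one)
    qed
    fix \<alpha>
    have "((\<lambda>r. of_real (r ^ (wlen k \<alpha> - wlen k \<gamma>)) * coord (A (chi \<gamma>)) \<alpha>)
        \<longlongrightarrow> of_real (1 ^ (wlen k \<alpha> - wlen k \<gamma>)) * coord (A (chi \<gamma>)) \<alpha>) (at_left 1)"
      by (intro tendsto_intros)
    then have "((\<lambda>r. of_real (r ^ (wlen k \<alpha> - wlen k \<gamma>)) * coord (A (chi \<gamma>)) \<alpha>)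
        \<longlongrightarrow> coord (A (chi \<gamma>)) \<alpha>) (at_left 1)"
      by simp
    then show "((\<lambda>r. coord (dilated_series k n lam c r (chi \<gamma>)) \<alpha>) \<longlongrightarrow> coord (A (chi \<gamma>)) \<alpha>) (at_left 1)"
      by (rule Lim_transform_eventually)
        (use eventually_at_left_1 in eventually_elim, simp add: coord_dilated_series_chi[OF _ _ \<gamma>])
  qed
qed (use A_bounded_operator eventually_at_left_1 in
    \<open>auto intro: dilated_series_bounded_operator norm_dilated_series_le\<close>)

end

theorem theorem2p3:
  fixes k :: nat and n :: "nat \<Rightarrow> nat"
    and lam :: "nat \<Rightarrow> nat \<Rightarrow> nat \<Rightarrow> nat \<Rightarrow> complex"
    and c :: "word_tuple \<Rightarrow> complex"
    and A :: "word_tuple oper"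
  assumes "k \<ge> 1"
    and "\<And>i. i \<in> {1..k} \<Longrightarrow> n i \<ge> 1"
    and "\<And>i j s t. \<lbrakk>i \<in> {1..k}; j \<in> {1..k}; i \<noteq> j; s \<in> {1..n i}; t \<in> {1..n j}\<rbrakk>
           \<Longrightarrow> cmod (lam i j s t) = 1"
    and "\<And>i j s t. \<lbrakk>i \<in> {1..k}; j \<in> {1..k}; i \<noteq> j; s \<in> {1..n i}; t \<in> {1..n j}\<rbrakk>
           \<Longrightarrow> lam j i t s = cnj (lam i j s t)"
    and "A \<in> hardy_algebra k n lam"
    and "fourier_rep k n lam c A"
  shows "(\<forall>r\<in>{0..<1}. summable (homogeneous_part k n lam c r) \<and>
             dilated_series k n lam c r \<in> poly_algebra k n lam) \<and>
         limitin strong_operator_topology (dilated_series k n lam c) A (at_left 1) \<and>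
         bdd_above ((\<lambda>r. norm (dilated_series k n lam c r)) ` {0..<1}) \<and>
         norm A = (SUP r\<in>{0..<1}. norm (dilated_series k n lam c r)) \<and>
         ((\<lambda>r. norm (dilated_series k n lam c r)) \<longlongrightarrow> norm A) (at_left 1)"
proof -
  interpret hardy_operator k n lam c A
    using assms(3,6) by unfold_locales
  let ?N = "\<lambda>r. norm (dilated_series k n lam c r)"
  have le: "?N r \<le> norm A" if "r \<in> {0..<1}" for r
    using that by (auto intro: norm_dilated_series_le)
  have bdd: "bdd_above (?N ` {0..<1})"
    using le by (rule bdd_aboveI2)
  have lim: "(?N \<longlongrightarrow> norm A) (at_left 1)"
    using eventually_at_left_1 le dilated_series_strong_limit
    by (intro norm_tendsto_of_strong_limit) (auto elim: eventually_mono)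
  \<comment> \<open>The norms lie below \<open>norm A\<close> and converge to it, which squeezes
    their supremum.\<close>
  have "norm A = (SUP r\<in>{0..<1}. ?N r)"
  proof (rule antisym)
    show "norm A \<le> (SUP r\<in>{0..<1}. ?N r)"
    proof (rule tendsto_upperbound[OF lim])
      show "\<forall>\<^sub>F r in at_left 1. ?N r \<le> (SUP r\<in>{0..<1}. ?N r)"
        using eventually_at_left_1 by eventually_elim (rule cSUP_upper[OF _ bdd])
    qed simp
    show "(SUP r\<in>{0..<1}. ?N r) \<le> norm A"
      using le by (intro cSUP_least) auto
  qed
  with bdd lim show ?thesis
    using summable_homogeneous_part dilated_series_mem_poly_algebra dilated_series_strong_limit
    by (auto simp: limitin_strong_operator_topology)
qed

end
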